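(* Let $n\ge2$, let $\Phi:\Delta\to\Delta$ be the $n$-dimensional Minkowski function defined in the context, and let $\lambda$ be the Lebesgue measure on $\Delta$, normalized so that $\lambda(\Delta)=1$. Then $\Phi$ is singular with respect to $\lambda$, i.e., there exists a measurable set $A\subseteq\Delta$ such that $\lambda(A)=1$ and $\lambda(\Phi[A])=0$.
   Context: Fix the integer $n$ and identify $\mathbb{R}^n$ with the hyperplane $\{x_{n+1}=1\}$ of $\mathbb{R}^{n+1}$. A vector $(\alpha_1,\ldots,\alpha_{n+1})\in\mathbb{R}^{n+1}$ with $\alpha_{n+1}>0$ gives, in projective coordinates, the point $(\alpha_1/\alpha_{n+1},\ldots,\alpha_n/\alpha_{n+1})$ of $\mathbb{R}^n$. Let $V$ be the $(n+1)\times(n+1)$ matrix all of whose entries are $0$, except $V_{ij}=1$ whenever $i=n+1$, or $j\ge2$ and $i+j\le n+2$. Let $\Delta$ be the $n$-simplex whose vertices $v_1,\ldots,v_{n+1}$ are given in projective coordinates by the columns of $V$ (so $\Delta=\{1\ge x_1\ge x_2\ge\cdots\ge x_n\ge0\}$). Let $A_0$ be the $(n+1)\times(n+1)$ matrix whose entries are $0$ except for entries $1$ in positions $(1,1)$, $(1,n+1)$, $(2,n+1)$ and $(j+1,j)$ for $2\le j\le n$; let $A_1$ be the same matrix except that the $1$ in position $(1,1)$ is moved to position $(2,1)$. For $a=0,1$ let $\Delta_a$ be the simplex whose vertices are given in projective coordinates by the columns of $VA_a$; one has $\Delta=\Delta_0\cup\Delta_1$. For $a=0,1$ the matrix $M_a=VA_a^{-1}V^{-1}\in\mathrm{GL}_{n+1}(\mathbb{Z})$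 induces a fractional-linear homeomorphism, also denoted $M_a$, from $\Delta_a$ to $\Delta$: the projective coordinates of $M_a(x)$ are $M_a(x_1\cdots x_n\,1)^{tr}$. The maps $M_0,M_1$ agree on $\Delta_0\cap\Delta_1$, and the Mönkemeyer map $M:\Delta\to\Delta$ is the continuous map with $M(x)=M_a(x)$ for $x\in\Delta_a$. In affine coordinates, $M(x_1,\ldots,x_n)=\bigl(\frac{x_1}{1-x_n},\frac{x_1-x_n}{1-x_n},\ldots,\frac{x_{n-1}-x_n}{1-x_n}\bigr)$ if $x_1+x_n\le1$ (i.e. on $\Delta_0$), and $M(x_1,\ldots,x_n)=\bigl(\frac{1-x_n}{x_1},\frac{x_1-x_n}{x_1},\ldots,\frac{x_{n-1}-x_n}{x_1}\bigr)$ if $x_1+x_n\ge1$ (i.e. on $\Delta_1$). For $a=0,1$ let $B_a$ be the matrix identical to $A_a$ except that the two $1$'s in the last column are replaced by $1/2$. The matrix $T_a=VB_a^{-1}V^{-1}$ has last row $(0\cdots0\,1)$ and induces an affine homeomorphism, also denoted $T_a$, from $\Delta_a$ to $\Delta$, by $T_a(x_1\cdots x_n\,1)^{tr}=(y_1\cdots y_n\,1)^{tr}$. The maps $T_0,T_1$ agree on $\Delta_0\cap\Delta_1$, and the tent map $T:\Delta\to\Delta$ is the continuous map with $T(x)=T_a(x)$ for $x\in\Delta_a$. In affine coordinates, $T(x_1,\ldots,x_n)=(x_1+x_n,x_1-x_n,\ldots,x_{n-1}-x_n)$ if $x_1+x_n\le1$, and $T(x_1,\ldots,x_n)=(2-x_1-x_n,x_1-x_n,\ldots,x_{n-1}-x_n)$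 if $x_1+x_n\ge1$. For $a_0,\ldots,a_{t-1}\in\{0,1\}$ let $\Delta_{a_0\ldots a_{t-1}}=\{x\in\Delta:M^i(x)\in\Delta_{a_i}\text{ for }0\le i\le t-1\}$ and $\Gamma_{a_0\ldots a_{t-1}}=\{x\in\Delta:T^i(x)\in\Delta_{a_i}\text{ for }0\le i\le t-1\}$ (both equal to $\Delta$ for $t=0$). For an infinite sequence $\bar a=a_0a_1a_2\ldots\in\{0,1\}^{\mathbb{N}}$, let $\varphi(\bar a)$ be the unique point of $\bigcap_{t\ge0}\Delta_{a_0\ldots a_{t-1}}$ and $\upsilon(\bar a)$ the unique point of $\bigcap_{t\ge0}\Gamma_{a_0\ldots a_{t-1}}$. The map $\Phi:\Delta\to\Delta$ is defined by $\Phi(p)=\upsilon(\bar a)$ for any $\bar a$ with $\varphi(\bar a)=p$; this is a well-defined homeomorphism, and it is the unique homeomorphism of $\Delta$ such that $T=\Phi\circ M\circ\Phi^{-1}$. *)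

theory Defs
  imports "HOL-Analysis.Analysis"
begin

text \<open>
  \<open>\<real>\<^sup>n\<close> is \<open>real ^ 'n\<close> for a finite linearly ordered index type with
  \<open>n = CARD('n)\<close>; the order only serves to number the coordinates \<open>1, \<dots>, n\<close>.
  Homogeneous coordinates live in \<open>real ^ ('n option)\<close>, where \<open>None\<close> is
  the additional coordinate \<open>n + 1\<close>. The function \<open>pos\<close> returns the number
  of a homogeneous coordinate.
\<close>

definition pos :: "'n::{finite,linorder} option \<Rightarrow> nat" where
  "pos k = (case k of None \<Rightarrow> CARD('n) + 1 | Some i \<Rightarrow> card {..i})"

definition hom_coords :: "real ^ 'n::finite \<Rightarrow> real ^ ('n option)" where
  "hom_coords x = (\<chi> k. case k of None \<Rightarrow> 1 | Some i \<Rightarrow> x $ i)"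

definition proj_point :: "real ^ ('n::finite option) \<Rightarrow> real ^ 'n" where
  "proj_point \<alpha> = (\<chi> i. \<alpha> $ Some i / \<alpha> $ None)"

definition proj_simplex ::
    "real ^ ('n::finite option) ^ ('n option) \<Rightarrow> (real ^ 'n) set" where
  "proj_simplex C = convex hull (range (\<lambda>j. proj_point (column j C)))"

definition V :: "real ^ ('n::{finite,linorder} option) ^ ('n option)" where
  "V = (\<chi> i j. if pos i = CARD('n) + 1 \<or> (2 \<le> pos j \<and> pos i + pos j \<le> CARD('n) + 2)
                then 1 else 0)"

text \<open>
  A digit \<open>a\<close> is a Boolean, \<open>False\<close> standing for \<open>0\<close> and \<open>True\<close> for \<open>1\<close>.
  The matrices \<open>A\<^sub>a\<close> and \<open>B\<^sub>a\<close> differ only in the value \<open>c\<close> of the two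
  nonzero entries of the last column.
\<close>

definition digit_matrix ::
    "real \<Rightarrow> bool \<Rightarrow> real ^ ('n::{finite,linorder} option) ^ ('n option)" where
  "digit_matrix c a = (\<chi> i j.
     if pos i = (if a then 2 else 1) \<and> pos j = 1 then 1
     else if (pos i = 1 \<or> pos i = 2) \<and> pos j = CARD('n) + 1 then c
     else if 2 \<le> pos j \<and> pos j \<le> CARD('n) \<and> pos i = pos j + 1 then 1
     else 0)"

definition A_mat :: "bool \<Rightarrow> real ^ ('n::{finite,linorder} option) ^ ('n option)" where
  "A_mat a = digit_matrix 1 a"

definition B_mat :: "bool \<Rightarrow> real ^ ('n::{finite,linorder} option) ^ ('n option)" where
  "B_mat a = digit_matrix (1/2) a"

definition Delta :: "(real ^ 'n::{finite,linorder}) set" where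
  "Delta = proj_simplex V"

definition Delta_digit :: "bool \<Rightarrow> (real ^ 'n::{finite,linorder}) set" where
  "Delta_digit a = proj_simplex (V ** A_mat a)"

definition M_mat :: "bool \<Rightarrow> real ^ ('n::{finite,linorder} option) ^ ('n option)" where
  "M_mat a = V ** matrix_inv (A_mat a) ** matrix_inv V"

definition T_mat :: "bool \<Rightarrow> real ^ ('n::{finite,linorder} option) ^ ('n option)" where
  "T_mat a = V ** matrix_inv (B_mat a) ** matrix_inv V"

definition M_branch :: "bool \<Rightarrow> real ^ 'n::{finite,linorder} \<Rightarrow> real ^ 'n::{finite,linorder}" where
  "M_branch a x = proj_point (M_mat a *v hom_coords x)"

definition T_branch :: "bool \<Rightarrow> real ^ 'n::{finite,linorder} \<Rightarrow> real ^ 'n::{finite,linorder}" where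
  "T_branch a x = (\<chi> i. (T_mat a *v hom_coords x) $ Some i)"

text \<open>
  On the common face of the two pieces of \<open>\<Delta>\<close> the two branches agree, so giving
  precedence to the digit \<open>0\<close> there is immaterial. Only values on \<open>\<Delta>\<close> matter.
\<close>

definition moenkemeyer_map :: "real ^ 'n::{finite,linorder} \<Rightarrow> real ^ 'n::{finite,linorder}" where
  "moenkemeyer_map x = (if x \<in> Delta_digit False then M_branch False x else M_branch True x)"

definition tent_map :: "real ^ 'n::{finite,linorder} \<Rightarrow> real ^ 'n::{finite,linorder}" where
  "tent_map x = (if x \<in> Delta_digit False then T_branch False x else T_branch True x)"

text \<open>\<open>cylinder f a t\<close> depends only on the first \<open>t\<close> digits of \<open>a\<close>.\<close>

definition cylinder ::
    "(real ^ 'n::{finite,linorder} \<Rightarrow> real ^ 'n::{finite,linorder}) \<Rightarrow> (nat \<Rightarrow> bool) \<Rightarrow> nat \<Rightarrow> (real ^ 'n::{finite,linorder}) set" where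
  "cylinder f a t = {x \<in> Delta. \<forall>i<t. (f ^^ i) x \<in> Delta_digit (a i)}"

definition phi :: "(nat \<Rightarrow> bool) \<Rightarrow> real ^ 'n::{finite,linorder}" where
  "phi a = (THE x. x \<in> (\<Inter>t. cylinder moenkemeyer_map a t))"

definition upsilon :: "(nat \<Rightarrow> bool) \<Rightarrow> real ^ 'n::{finite,linorder}" where
  "upsilon a = (THE x. x \<in> (\<Inter>t. cylinder tent_map a t))"

text \<open>
  A point may have several codes \<open>a\<close>; they all yield the same value \<open>upsilon a\<close>,
  so any of them may be chosen.
\<close>

definition Minkowski :: "real ^ 'n::{finite,linorder} \<Rightarrow> real ^ 'n::{finite,linorder}" where
  "Minkowski p = upsilon (SOME a. phi a = p)"

definition normalized_lebesgue :: "(real ^ 'n::{finite,linorder}) measure" where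
  "normalized_lebesgue = uniform_measure lebesgue Delta"

end

theory Submission imports Defs begin

text \<open>
  The maps \<open>M\<close> and \<open>T\<close> cut \<open>\<Delta>\<close> in the same combinatorial way: a simplex with vertices
  \<open>w\<^sub>1, \<dots>, w\<^sub>n\<^sub>+\<^sub>1\<close> in homogeneous coordinates is bisected at \<open>w\<^sub>1 + w\<^sub>2\<close>. If \<open>q\<^sub>j\<close> is the
  last coordinate of \<open>w\<^sub>j\<close>, then the two pieces have relative volumes \<open>q\<^sub>2/(q\<^sub>1 + q\<^sub>2)\<close> and
  \<open>q\<^sub>1/(q\<^sub>1 + q\<^sub>2)\<close>, which are both \<open>1/2\<close> in the case of \<open>T\<close>. For \<open>M\<close> they cannot stay close
  to \<open>1/2\<close> for \<open>n + 1\<close> consecutive steps. Hence the sum of \<open>sqrt (\<lambda>(\<Delta>\<^sub>w) \<lambda>(\<Gamma>\<^sub>w))\<close> over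
  the words \<open>w\<close> of length \<open>t\<close> decays exponentially in \<open>t\<close>, and by Borel and Cantelli almost
  every point lies eventually in cylinders \<open>\<Delta>\<^sub>w\<close> larger than \<open>\<Gamma>\<^sub>w\<close>, while the union of
  the corresponding \<open>\<Gamma>\<^sub>w\<close> has summable measure.

  For \<open>\<phi>\<close> and \<open>\<upsilon>\<close> to be meaningful, the nested simplices have to shrink to a point. In
  every product of \<open>n\<^sup>2\<close> digit matrices any two columns are both positive in some row, so
  that the diameter contracts by a factor \<open>1 - \<sigma>\<close>; since \<open>q\<^sub>i \<le> (t + 1) q\<^sub>j\<close> after \<open>t\<close> steps,
  \<open>\<sigma>\<close> can be taken of order \<open>1/t\<close>, and the harmonic series diverges.
\<close>

section \<open>Bisection\<close>

text \<open>
  The columns of \<open>W A\<^sub>b\<close> (\<open>c = 1\<close>) or \<open>W B\<^sub>b\<close> (\<open>c = 1/2\<close>) in terms of the columns of \<open>W\<close>,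
  numbered from \<open>1\<close>. Column \<open>1\<close> is called the champion below, and the others form a queue: the
  first of the queue leaves it and either is dropped or replaces the champion.
\<close>

definition bisect :: "nat \<Rightarrow> real \<Rightarrow> bool \<Rightarrow> (nat \<Rightarrow> 'v::real_vector) \<Rightarrow> nat \<Rightarrow> 'v" where
  "bisect n c b w j = (if j = 1 then w (if b then 2 else 1)
     else if j = n + 1 then c *\<^sub>R (w 1 + w 2) else w (Suc j))"

lemma fold_bisect_snoc:
  "fold (bisect n c) (bs @ [b]) w j = (if j = 1 then fold (bisect n c) bs w (if b then 2 else 1)
     else if j = n + 1 then c *\<^sub>R (fold (bisect n c) bs w 1 + fold (bisect n c) bs w 2)
     else fold (bisect n c) bs w (Suc j))"
  by (simp only: fold_append fold.simps comp_apply id_apply) (rule bisect_def)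

text \<open>Folding \<open>bisect\<close> over \<open>unit_mass k\<close> traces row k of a product
  of digit matrices: its value at j is the coefficient of \<open>w k\<close> in column j, as
  \<open>fold_bisect_sum\<close> makes precise.\<close>

definition unit_mass :: "nat \<Rightarrow> nat \<Rightarrow> real" where "unit_mass k i = (if i = k then 1 else 0)"

text \<open>Applied to the last homogeneous coordinate and to the vector of the others, this makes
  the denominators and numerators of the vertices evolve by the same rule as the vertices.\<close>

lemma linear_fold_bisect:
  assumes "linear h"
  shows "h (fold (bisect n c) bs w j) = fold (bisect n c) bs (\<lambda>i. h (w i)) j"
proof (induction bs arbitrary: j rule: rev_induct)
  case (snoc b bs)
  then show ?case
    using linear_add[OF assms] linear_scale[OF assms] by (simp add: fold_bisect_snoc del: fold_append)
qed simp

lemma fold_bisect_sum: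
  assumes "1 \<le> n" "j \<in> {1..n+1}"
  shows "fold (bisect n c) bs w j = (\<Sum>k=1..n+1. fold (bisect n c) bs (unit_mass k) j *\<^sub>R w k)"
  using assms(2)
proof (induction bs arbitrary: j rule: rev_induct)
  case Nil
  then have "(\<Sum>k=1..n+1. unit_mass k j *\<^sub>R w k) = (\<Sum>k=1..n+1. if k = j then w k else 0)"
    by (intro sum.cong) (auto simp: unit_mass_def)
  with Nil show ?case by simp
next
  case (snoc b bs)
  let ?W = "fold (bisect n c) bs"
  consider "j = 1" | "j = n + 1" "j \<noteq> 1" | "j \<noteq> 1" "j \<noteq> n + 1" by blast
  then show ?case
  proof cases
    case 1
    have "(if b then 2 else 1::nat) \<in> {1..n+1}" using assms(1) by auto
    from snoc.IH[OF this] 1 show ?thesis by (simp add: fold_bisect_snoc del: fold_append)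
  next
    case 2
    have "1 \<in> {1..n+1}" "2 \<in> {1..n+1}" using assms(1) by auto
    from snoc.IH[OF this(1)] snoc.IH[OF this(2)] 2 assms(1) show ?thesis
      by (simp add: fold_bisect_snoc scaleR_add_left scaleR_right_distrib scaleR_sum_right sum.distrib
          distrib_left del: sum.cl_ivl_Suc fold_append)
  next
    case 3
    then have "Suc j \<in> {1..n+1}" using snoc.prems by auto
    from snoc.IH[OF this] 3 show ?thesis by (simp add: fold_bisect_snoc del: fold_append)
  qed
qed

text \<open>Nothing cancels in a new column, so the smallest nonzero entry shrinks by at most a
  factor \<open>c\<close> per step. This turns mere positivity into a uniform lower bound.\<close>

lemma fold_bisect_unit_mass_lower:
  assumes "0 < c" "c \<le> 1"
  shows "fold (bisect n c) bs (unit_mass k) j = 0 \<or> c ^ length bs \<le> fold (bisect n c) bs (unit_mass k) j"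
proof (induction bs arbitrary: j rule: rev_induct)
  case Nil
  then show ?case by (auto simp: unit_mass_def)
next
  case (snoc b bs)
  let ?p = "fold (bisect n c) bs (unit_mass k)"
  have pos: "0 \<le> ?p i" for i using snoc.IH[of i] zero_less_power[OF assms(1), of "length bs"] by linarith
  have low: "c ^ Suc (length bs) \<le> c ^ length bs" using assms by (simp add: mult_left_le_one_le)
  have s: "?p i = 0 \<or> c ^ Suc (length bs) \<le> ?p i" for i using snoc.IH[of i] low by linarith
  have "c * (?p 1 + ?p 2) = 0 \<or> c ^ Suc (length bs) \<le> c * (?p 1 + ?p 2)"
  proof (cases "?p 1 + ?p 2 = 0")
    case False
    then have "c ^ length bs \<le> ?p 1 + ?p 2"
      using snoc.IH[of 1] snoc.IH[of 2] pos[of 1] pos[of 2] by linarith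
    then show ?thesis using assms(1) by simp
  qed simp
  then show ?case using s by (simp add: fold_bisect_snoc del: fold_append)
qed

lemma fold_bisect_unit_mass_nonneg:
  assumes "0 < c" "c \<le> 1"
  shows "0 \<le> fold (bisect n c) bs (unit_mass k) j"
  using fold_bisect_unit_mass_lower[OF assms, of n bs k j] zero_less_power[OF assms(1), of "length bs"]
  by linarith

lemma fold_bisect_pos:
  assumes "0 < c" "1 \<le> n" "\<And>j. j \<in> {1..n+1} \<Longrightarrow> (0::real) < q j" "j \<in> {1..n+1}"
  shows "0 < fold (bisect n c) bs q j"
  using assms(4)
proof (induction bs arbitrary: j rule: rev_induct)
  case (snoc b bs)
  have "0 < fold (bisect n c) bs q 1" "0 < fold (bisect n c) bs q 2"
    using assms(2) by (auto intro!: snoc.IH)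
  with snoc.prems assms(1) show ?case
    by (auto simp: fold_bisect_snoc simp del: fold_append intro!: snoc.IH mult_pos_pos add_pos_pos)
qed (use assms in auto)

lemma fold_bisect_le_power:
  assumes "0 < c" "c \<le> 1" "1 \<le> n" "\<And>j. j \<in> {1..n+1} \<Longrightarrow> (q j::real) \<le> K" "0 \<le> K" "j \<in> {1..n+1}"
  shows "fold (bisect n c) bs q j \<le> 2 ^ length bs * K"
  using assms(6)
proof (induction bs arbitrary: j rule: rev_induct)
  case (snoc b bs)
  let ?p = "fold (bisect n c) bs q" and ?K = "2 ^ length bs * K"
  have 12: "?p 1 \<le> ?K" "?p 2 \<le> ?K" using assms(3) by (auto intro!: snoc.IH)
  have K: "0 \<le> ?K" using assms by simp
  have "c * (?p 1 + ?p 2) \<le> c * (2 * ?K)" using 12 assms(1) by (intro mult_left_mono) auto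
  also have "\<dots> \<le> 2 * ?K" using assms K by (intro mult_left_le_one_le) auto
  finally have new: "c * (?p 1 + ?p 2) \<le> 2 * ?K" .
  have "Suc j \<in> {1..n+1} \<Longrightarrow> ?p (Suc j) \<le> ?K" by (rule snoc.IH)
  with snoc.prems 12 new K show ?case
    by (auto simp: fold_bisect_snoc simp del: fold_append)
qed (use assms in auto)

section \<open>Two columns of a long product share an ancestor\<close>

text \<open>Only the two front positions matter: with k kept and d dropped, the marks on k and d are
  replaced by the mark on k and the conjunction of both. So a mark is lost exactly if d is marked
  and k is not.\<close>

lemma bool_queue_count:
  fixes F :: "nat \<Rightarrow> nat \<Rightarrow> bool"
  assumes n: "1 \<le> n"
    and F: "\<And>s j. j \<in> {1..n+1} \<Longrightarrow> F (Suc s) j =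
      (if j = 1 then F s (if a s then 2 else 1) else if j = n + 1 then F s 1 \<and> F s 2 else F s (Suc j))"
  shows "card {j\<in>{1..n+1}. F (Suc s) j} + (if F s (if a s then 1 else 2) \<and> \<not> F s (if a s then 2 else 1) then 1 else 0)
     = card {j\<in>{1..n+1}. F s j}"
proof -
  have c: "card {j\<in>{1..n+1}. P j} = (\<Sum>j=1..n+1. if P j then 1 else 0)" for P
    by (simp add: sum.inter_filter[symmetric] del: sum.cl_ivl_Suc)
  have split: "(\<Sum>j=1..n+1. f j) = f 1 + (\<Sum>j=2..n+1. f j)" for f :: "nat \<Rightarrow> nat"
    using n by (simp add: sum.atLeast_Suc_atMost numeral_2_eq_2)
  have split2: "(\<Sum>j=2..n+1. f j) = f 2 + (\<Sum>j=3..n+1. f j)" for f :: "nat \<Rightarrow> nat"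
    using n by (cases "n = 1") (simp_all add: sum.atLeast_Suc_atMost numeral_2_eq_2 numeral_3_eq_3)
  have split3: "(\<Sum>j=2..n+1. f j) = (\<Sum>j=2..n. f j) + f (n+1)" for f :: "nat \<Rightarrow> nat"
    using n by simp
  have sh: "(\<Sum>j=2..n. if F (Suc s) j then 1 else 0::nat) = (\<Sum>j=3..n+1. if F s j then 1 else 0)"
  proof -
    have "(\<Sum>j=2..n. if F (Suc s) j then 1 else 0::nat) = (\<Sum>j=2..n. if F s (Suc j) then 1 else 0)"
      using F by (intro sum.cong) auto
    also have "\<dots> = (\<Sum>j=3..n+1. if F s j then 1 else 0)"
      using sum.shift_bounds_cl_Suc_ivl[of "\<lambda>j. if F s j then 1 else 0::nat" 2 n]
      by (simp add: numeral_3_eq_3 numeral_2_eq_2 del: sum.cl_ivl_Suc)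
    finally show ?thesis .
  qed
  have e: "F (Suc s) 1 = F s (if a s then 2 else 1)" "F (Suc s) (n+1) = (F s 1 \<and> F s 2)"
    using F[of 1 s] F[of "n+1" s] n by auto
  let ?f = "\<lambda>s j. if F s j then 1 else 0::nat"
  have A: "(\<Sum>j=1..n+1. ?f (Suc s) j) = ?f (Suc s) 1 + ((\<Sum>j=2..n. ?f (Suc s) j) + ?f (Suc s) (n+1))"
    using split[of "?f (Suc s)"] split3[of "?f (Suc s)"] by presburger
  have B: "(\<Sum>j=1..n+1. ?f s j) = ?f s 1 + (?f s 2 + (\<Sum>j=3..n+1. ?f s j))"
    using split[of "?f s"] split2[of "?f s"] by presburger
  show ?thesis unfolding c A B sh e by auto
qed

text \<open>While the champion is unmarked every new entry is unmarked, and after \<open>n\<close>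
  steps the whole queue consists of new entries.\<close>

lemma bool_queue_empty:
  fixes F :: "nat \<Rightarrow> nat \<Rightarrow> bool"
  assumes n: "1 \<le> n"
    and F: "\<And>s j. j \<in> {1..n+1} \<Longrightarrow> F (Suc s) j =
      (if j = 1 then F s (if a s then 2 else 1) else if j = n + 1 then F s 1 \<and> F s 2 else F s (Suc j))"
    and no: "\<And>i. i \<le> n \<Longrightarrow> \<not> F (s + i) 1"
  shows "\<forall>j\<in>{1..n+1}. \<not> F (s + n) j"
proof -
  have "\<forall>j\<in>{n+2-i..n+1}. \<not> F (s + i) j" if "i \<le> n" for i
    using that
  proof (induction i)
    case (Suc i)
    show ?case
    proof
      fix j assume j: "j \<in> {n+2 - Suc i..n+1}"
      then have j': "j \<in> {1..n+1}" "j \<noteq> 1" using Suc.prems by auto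
      have "\<not> F (s + i) 1" using no Suc.prems by simp
      then show "\<not> F (s + Suc i) j"
        using F[OF j'(1), of "s+i"] j j' Suc by (auto split: if_splits)
    qed
  qed auto
  from this[of n] no[of n] show ?thesis
    by (metis (no_types, lifting) Suc_1 add_2_eq_Suc' add_diff_cancel_left' atLeastAtMost_iff diff_add_inverse le_antisym not_less_eq_eq order_refl One_nat_def add.commute)
qed

text \<open>Two disjoint families of marks compete for the champion. During \<open>n\<close> steps a
  surviving family holds the champion at least once (\<open>bool_queue_empty\<close>), so if both
  survive, one of them loses it and with it a mark. At most \<open>n + 1\<close> marks cannot pay
  for \<open>n\<close> such losses and leave two.\<close>

lemma bool_queue_disjoint:
  fixes F G :: "nat \<Rightarrow> nat \<Rightarrow> bool"
  assumes n: "1 \<le> n"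
    and F: "\<And>s j. j \<in> {1..n+1} \<Longrightarrow> F (Suc s) j =
      (if j = 1 then F s (if a s then 2 else 1) else if j = n + 1 then F s 1 \<and> F s 2 else F s (Suc j))"
    and G: "\<And>s j. j \<in> {1..n+1} \<Longrightarrow> G (Suc s) j =
      (if j = 1 then G s (if a s then 2 else 1) else if j = n + 1 then G s 1 \<and> G s 2 else G s (Suc j))"
    and disj: "\<And>s j. j \<in> {1..n+1} \<Longrightarrow> \<not> (F s j \<and> G s j)"
  shows "(\<forall>j\<in>{1..n+1}. \<not> F (n * n) j) \<or> (\<forall>j\<in>{1..n+1}. \<not> G (n * n) j)"
proof (rule ccontr)
  assume "\<not> ?thesis"
  then have neF: "\<exists>j\<in>{1..n+1}. F (n*n) j" and neG: "\<exists>j\<in>{1..n+1}. G (n*n) j" by auto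
  define NF where "NF s = card {j\<in>{1..n+1}. F s j}" for s
  define NG where "NG s = card {j\<in>{1..n+1}. G s j}" for s
  note cF = bool_queue_count[of n F a, OF n F, folded NF_def]
  note cG = bool_queue_count[of n G a, OF n G, folded NG_def]
  have "NF (Suc s) \<le> NF s" "NG (Suc s) \<le> NG s" for s using cF[of s] cG[of s] by linarith+
  then have mF: "NF t \<le> NF s" and mG: "NG t \<le> NG s" if "s \<le> t" for s t
    using that by (auto intro: lift_Suc_antimono_le)
  \<comment> \<open>The title passes out of a family only when a marked champion is dropped in
    favour of an unmarked challenger, the one case in which \<open>bool_queue_count\<close> records
    a loss.\<close>
  have leave: "N v < N u"
    if u: "X u 1" "\<not> X v 1" "u \<le> v"
      and X: "\<And>s j. j \<in> {1..n+1} \<Longrightarrow> X (Suc s) j =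
      (if j = 1 then X s (if a s then 2 else 1) else if j = n + 1 then X s 1 \<and> X s 2 else X s (Suc j))"
      and N: "\<And>s. N (Suc s) + (if X s (if a s then 1 else 2) \<and> \<not> X s (if a s then 2 else 1) then 1 else 0) = N s"
    for X :: "nat \<Rightarrow> nat \<Rightarrow> bool" and N :: "nat \<Rightarrow> nat" and u v
  proof -
    have dec: "N (Suc s) \<le> N s" for s using N[of s] by linarith
    show ?thesis using u(3,2)
    proof (induction v rule: dec_induct)
      case base
      then show ?case using u by simp
    next
      case (step v)
      show ?case
      proof (cases "X v 1")
        case True
        with step.prems X[of 1 v] have "a v" "\<not> X v 2" by (auto split: if_splits)
        with N[of v] True have "N (Suc v) < N v" by simp
        moreover have "N v \<le> N u"
          using step.hyps(1) by (rule lift_Suc_antimono_le[of N, rotated]) (rule dec)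
        ultimately show ?thesis by simp
      next
        case False
        with step.IH dec[of v] show ?thesis by linarith
      qed
    qed
  qed
  \<comment> \<open>Read backwards: a marked position always has a marked predecessor, so a family
    that is nonempty at time \<open>n * n\<close> was nonempty before.\<close>
  have ne: "\<exists>j\<in>{1..n+1}. X s j" if "s \<le> n*n" "\<exists>j\<in>{1..n+1}. X (n*n) j"
      and X: "\<And>s j. j \<in> {1..n+1} \<Longrightarrow> X (Suc s) j =
      (if j = 1 then X s (if a s then 2 else 1) else if j = n + 1 then X s 1 \<and> X s 2 else X s (Suc j))"
    for X :: "nat \<Rightarrow> nat \<Rightarrow> bool" and s
    using that(1,2)
  proof (induction s rule: inc_induct)
    case (step s)
    then obtain j where j: "j \<in> {1..n+1}" "X (Suc s) j" by blast
    have "1 \<in> {1..n+1}" "2 \<in> {1..n+1}" "j \<noteq> n+1 \<Longrightarrow> Suc j \<in> {1..n+1}" using n j by auto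
    moreover have "j = 1 \<and> (X s 1 \<or> X s 2) \<or> j = n + 1 \<and> X s 1 \<or> j \<noteq> n + 1 \<and> X s (Suc j)"
      using j(2) X[OF j(1), of s] by (auto split: if_splits)
    ultimately show ?case by blast
  qed auto
  have drop: "NF (k * n + n) + NG (k * n + n) < NF (k * n) + NG (k * n)" if "k < n" for k
  proof -
    have kn: "k * n + n \<le> n * n" using that by (metis Suc_leI mult_Suc mult_le_mono1 add.commute)
    obtain i where i: "i \<le> n" "F (k*n+i) 1"
      using bool_queue_empty[of n F a "k*n", OF n F] ne[OF kn neF F] by blast
    obtain l where l: "l \<le> n" "G (k*n+l) 1"
      using bool_queue_empty[of n G a "k*n", OF n G] ne[OF kn neG G] by blast
    have "\<not> F (k*n+l) 1" "\<not> G (k*n+i) 1" using disj[of 1] i l by auto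
    consider "i \<le> l" | "l \<le> i" by linarith
    then show ?thesis
    proof cases
      case 1
      have "NF (k*n+l) < NF (k*n+i)"
        by (rule leave[of F, OF i(2) _ _ F cF]) (use 1 \<open>\<not> F (k*n+l) 1\<close> in auto)
      moreover have "NF (k*n+n) \<le> NF (k*n+l)" "NF (k*n+i) \<le> NF (k*n)" "NG (k*n+n) \<le> NG (k*n)"
        using l by (auto intro!: mF mG)
      ultimately show ?thesis by linarith
    next
      case 2
      have "NG (k*n+i) < NG (k*n+l)"
        by (rule leave[of G, OF l(2) _ _ G cG]) (use 2 \<open>\<not> G (k*n+i) 1\<close> in auto)
      moreover have "NG (k*n+n) \<le> NG (k*n+i)" "NG (k*n+l) \<le> NG (k*n)" "NF (k*n+n) \<le> NF (k*n)"
        using i by (auto intro!: mF mG)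
      ultimately show ?thesis by linarith
    qed
  qed
  \<comment> \<open>Disjointness bounds the initial marks by the number of positions, and each block
    of \<open>n\<close> steps consumes one. For \<open>k = n\<close> a single mark remains for two
    nonempty families.\<close>
  have "NF (k * n) + NG (k * n) + k \<le> n + 1" if "k \<le> n" for k
    using that
  proof (induction k)
    case 0
    have "NF 0 + NG 0 = card ({j\<in>{1..n+1}. F 0 j} \<union> {j\<in>{1..n+1}. G 0 j})"
      unfolding NF_def NG_def using disj[of _ 0] by (intro card_Un_disjoint[symmetric]) auto
    also have "\<dots> \<le> card {1..n+1}" by (intro card_mono) auto
    finally show ?case by simp
  next
    case (Suc k)
    then show ?case using drop[of k] by (simp add: add.commute)
  qed
  from this[of n] have "NF (n*n) + NG (n*n) \<le> 1" by simp
  moreover have "0 < NF (n*n)" "0 < NG (n*n)"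
    unfolding NF_def NG_def using neF neG by (auto simp: card_gt_0_iff)
  ultimately show False by linarith
qed

text \<open>Mark a column for \<open>i\<close> if its support lies in the support of the final
  column \<open>i\<close>, and likewise for \<open>j\<close>. If the final supports of
  \<open>i\<close> and \<open>j\<close> were disjoint, these would be two disjoint families of marks
  that both survive, against \<open>bool_queue_disjoint\<close>.\<close>

lemma scrambling:
  assumes n: "1 \<le> n" and c: "0 < c" "c \<le> 1" and len: "length bs = n * n"
    and ij: "i \<in> {1..n+1}" "j \<in> {1..n+1}"
  shows "\<exists>k\<in>{1..n+1}. 0 < fold (bisect n c) bs (unit_mass k) i \<and> 0 < fold (bisect n c) bs (unit_mass k) j"
proof (rule ccontr)
  assume contra: "\<not> ?thesis"
  \<comment> \<open>The digits are repeated with period \<open>n * n\<close> so that the recursion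
    is available at all times, as the queue lemmas ask; the first \<open>n * n\<close> steps are the
    given word.\<close>
  define P where "P s k m = fold (bisect n c) (map (\<lambda>i. bs ! (i mod (n*n))) [0..<s]) (unit_mass k) m" for s k m
  have P0: "0 \<le> P s k m" for s k m unfolding P_def by (rule fold_bisect_unit_mass_nonneg[OF c])
  have PS: "P (Suc s) k m = bisect n c (bs ! (s mod (n*n))) (P s k) m" for s k m
    unfolding P_def by (simp only: upt_Suc_append[OF le0] map_append list.map fold_append fold.simps comp_apply id_apply)
  have "map (\<lambda>i. bs ! (i mod (n*n))) [0..<n*n] = bs"
    using len by (intro nth_equalityI) auto
  then have PL: "P (n*n) k m = fold (bisect n c) bs (unit_mass k) m" for k m by (simp add: P_def)
  define H where "H e s m = (\<forall>k\<in>{1..n+1}. 0 < P s k m \<longrightarrow> 0 < P (n*n) k e)" for e s m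
  \<comment> \<open>As nothing cancels, the support of a new column is the union of the two front
    supports, and a union is contained in a set exactly if both parts are.\<close>
  have rec: "H e (Suc s) m = (if m = 1 then H e s (if bs ! (s mod (n*n)) then 2 else 1)
     else if m = n + 1 then H e s 1 \<and> H e s 2 else H e s (Suc m))"
    if "m \<in> {1..n+1}" for e s m
  proof -
    have "0 < c * (P s k 1 + P s k 2) \<longleftrightarrow> 0 < P s k 1 \<or> 0 < P s k 2" for k
      using c P0[of s k 1] P0[of s k 2] by (auto simp: zero_less_mult_iff)
    then show ?thesis
      using n by (auto simp: H_def PS bisect_def)
  qed
  \<comment> \<open>The sum of column m is the fold of the constant 1, which stays positive; so no
    support is empty, and none can lie in two disjoint sets.\<close>
  have sup: "\<exists>k\<in>{1..n+1}. 0 < P s k m" if "m \<in> {1..n+1}" for s m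
  proof (rule ccontr)
    assume "\<not> ?thesis"
    then have "P s k m = 0" if "k \<in> {1..n+1}" for k using P0[of s k m] that by force
    then have "fold (bisect n c) (map (\<lambda>i. bs ! (i mod (n*n))) [0..<s]) (\<lambda>_. 1::real) m = 0"
      unfolding P_def by (subst fold_bisect_sum[OF n that]) auto
    with fold_bisect_pos[OF c(1) n, of "\<lambda>_. 1" m "map (\<lambda>i. bs ! (i mod (n*n))) [0..<s]"] that
    show False by simp
  qed
  have disj: "\<not> (H i s m \<and> H j s m)" if "m \<in> {1..n+1}" for s m
    using sup[OF that, of s] contra by (auto simp: H_def PL)
  have "H i (n*n) i" "H j (n*n) j" by (auto simp: H_def)
  with bool_queue_disjoint[of n "H i" _ "H j", OF n rec rec disj] ij show False by blast
qed

section \<open>Contraction\<close>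

text \<open>A coupling argument: the mass \<sigma> that both weights put on \<open>k0\<close>
  cancels in the difference, and only the remaining mass \<open>1 - \<sigma>\<close> has to be
  transported, over distances at most \<open>E\<close>.\<close>

lemma norm_weighted_diff_le:
  fixes x :: "nat \<Rightarrow> 'v::real_normed_vector"
  assumes R: "finite R" "k0 \<in> R"
    and a: "\<And>k. k \<in> R \<Longrightarrow> 0 \<le> a k" "sum a R = 1" "\<sigma> \<le> a k0"
    and b: "\<And>k. k \<in> R \<Longrightarrow> 0 \<le> b k" "sum b R = 1" "\<sigma> \<le> b k0"
    and E: "\<And>i j. i \<in> R \<Longrightarrow> j \<in> R \<Longrightarrow> norm (x i - x j) \<le> E"
  shows "norm ((\<Sum>k\<in>R. a k *\<^sub>R x k) - (\<Sum>k\<in>R. b k *\<^sub>R x k)) \<le> (1 - \<sigma>) * E"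
proof -
  define f where "f k = a k - (if k = k0 then \<sigma> else 0)" for k
  define g where "g k = b k - (if k = k0 then \<sigma> else 0)" for k
  have f0: "0 \<le> f k" "0 \<le> g k" if "k \<in> R" for k using a b that by (auto simp: f_def g_def)
  have fs: "sum f R = 1 - \<sigma>" "sum g R = 1 - \<sigma>"
    using a b R by (simp_all add: f_def g_def sum_subtractf)
  have eq: "(\<Sum>k\<in>R. a k *\<^sub>R x k) - (\<Sum>k\<in>R. b k *\<^sub>R x k)
      = (\<Sum>k\<in>R. f k *\<^sub>R x k) - (\<Sum>k\<in>R. g k *\<^sub>R x k)"
    by (simp add: sum_subtractf[symmetric] scaleR_diff_left[symmetric] f_def g_def)
  \<comment> \<open>Both remainders have total mass \<open>1 - \<sigma>\<close>, so up to this
    factor they are the marginals of the product weights \<open>f k * g l\<close>.\<close>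
  have "(1 - \<sigma>) *\<^sub>R ((\<Sum>k\<in>R. f k *\<^sub>R x k) - (\<Sum>k\<in>R. g k *\<^sub>R x k))
      = (\<Sum>k\<in>R. \<Sum>l\<in>R. (f k * g l) *\<^sub>R (x k - x l))"
  proof -
    have "(\<Sum>k\<in>R. \<Sum>l\<in>R. (f k * g l) *\<^sub>R (x k - x l))
       = (\<Sum>k\<in>R. \<Sum>l\<in>R. (f k * g l) *\<^sub>R x k) - (\<Sum>k\<in>R. \<Sum>l\<in>R. (f k * g l) *\<^sub>R x l)"
      by (simp add: scaleR_diff_right sum_subtractf)
    also have "(\<Sum>k\<in>R. \<Sum>l\<in>R. (f k * g l) *\<^sub>R x k) = (\<Sum>k\<in>R. (1 - \<sigma>) *\<^sub>R (f k *\<^sub>R x k))"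
      by (simp add: scaleR_sum_left[symmetric] sum_distrib_left[symmetric] fs mult.commute)
    also have "(\<Sum>k\<in>R. \<Sum>l\<in>R. (f k * g l) *\<^sub>R x l) = (\<Sum>l\<in>R. (1 - \<sigma>) *\<^sub>R (g l *\<^sub>R x l))"
      by (subst sum.swap)
        (simp add: scaleR_sum_left[symmetric] sum_distrib_right[symmetric] fs)
    finally show ?thesis by (simp add: scaleR_sum_right scaleR_diff_right)
  qed
  also have "norm \<dots> \<le> (\<Sum>k\<in>R. \<Sum>l\<in>R. (f k * g l) * E)"
    using f0 E by (intro order_trans[OF norm_sum] sum_mono) (auto intro!: mult_left_mono)
  also have "\<dots> = (1 - \<sigma>) * ((1 - \<sigma>) * E)"
    by (simp add: sum_distrib_right[symmetric] sum_distrib_left[symmetric] fs mult.assoc)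
  finally have *: "\<bar>1 - \<sigma>\<bar> * norm ((\<Sum>k\<in>R. f k *\<^sub>R x k) - (\<Sum>k\<in>R. g k *\<^sub>R x k))
      \<le> (1 - \<sigma>) * ((1 - \<sigma>) * E)" by simp
  have "0 \<le> 1 - \<sigma>" using fs f0 sum_nonneg[of R f] by simp
  \<comment> \<open>For \<open>1 - \<sigma> = 0\<close> the factor cannot be divided out, but then
    both remainders vanish.\<close>
  then consider "1 - \<sigma> = 0" | "0 < 1 - \<sigma>" by linarith
  then show ?thesis
  proof cases
    case 1
    then have "f k = 0" "g k = 0" if "k \<in> R" for k
      using fs f0 R(1) that sum_nonneg_eq_0_iff[of R f] sum_nonneg_eq_0_iff[of R g] by auto
    with 1 show ?thesis unfolding eq by simp
  next
    case 2
    with * show ?thesis unfolding eq by (simp add: abs_of_pos)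
  qed
qed

text \<open>The new points are convex combinations of the old ones. In the row k given by
  \<open>scrambling\<close> both entries are at least \<open>c ^ (n*n)\<close>, while the new
  denominators are at most \<open>2 ^ (n*n) * K * q k\<close>; hence both combinations give point k
  at least the weight \<open>(c/2) ^ (n*n) / K\<close>.\<close>

lemma fold_bisect_contraction:
  fixes X :: "nat \<Rightarrow> 'v::real_normed_vector"
  assumes n: "1 \<le> n" and c: "0 < c" "c \<le> 1" and len: "length bs = n * n"
    and q: "\<And>j. j \<in> {1..n+1} \<Longrightarrow> 0 < q j"
    and K: "\<And>i j. i \<in> {1..n+1} \<Longrightarrow> j \<in> {1..n+1} \<Longrightarrow> q i \<le> K * q j"
    and E: "\<And>i j. i \<in> {1..n+1} \<Longrightarrow> j \<in> {1..n+1} \<Longrightarrow> norm (X i /\<^sub>R q i - X j /\<^sub>R q j) \<le> E"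
    and ij: "i \<in> {1..n+1}" "j \<in> {1..n+1}"
  shows "norm (fold (bisect n c) bs X i /\<^sub>R fold (bisect n c) bs q i
      - fold (bisect n c) bs X j /\<^sub>R fold (bisect n c) bs q j) \<le> (1 - (c/2) ^ (n*n) / K) * E"
proof -
  let ?R = "{1..n+1}"
  define P where "P k m = fold (bisect n c) bs (unit_mass k) m" for k m
  define Q where "Q m = fold (bisect n c) bs q m" for m
  define w where "w m k = P k m * q k / Q m" for m k
  have Q: "0 < Q m" if "m \<in> ?R" for m
    unfolding Q_def by (intro fold_bisect_pos[OF c(1) n] q that)
  have Qs: "Q m = (\<Sum>k\<in>?R. P k m * q k)" if "m \<in> ?R" for m
    unfolding Q_def P_def using fold_bisect_sum[OF n that, of c bs q] by simp
  have P: "0 \<le> P k m" for k m unfolding P_def by (rule fold_bisect_unit_mass_nonneg[OF c])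
  have x: "fold (bisect n c) bs X m /\<^sub>R Q m = (\<Sum>k\<in>?R. w m k *\<^sub>R (X k /\<^sub>R q k))" if "m \<in> ?R" for m
  proof -
    have "fold (bisect n c) bs X m /\<^sub>R Q m = (\<Sum>k\<in>?R. (P k m *\<^sub>R X k) /\<^sub>R Q m)"
      by (simp only: fold_bisect_sum[OF n that, of c bs X] P_def scaleR_sum_right)
    also have "\<dots> = (\<Sum>k\<in>?R. w m k *\<^sub>R (X k /\<^sub>R q k))"
      using q by (intro sum.cong refl) (force simp: w_def field_simps)
    finally show ?thesis .
  qed
  have w0: "0 \<le> w m k" if "m \<in> ?R" "k \<in> ?R" for m k
    using P Q[OF that(1)] q[OF that(2)] by (simp add: w_def less_imp_le)
  have w1: "sum (w m) ?R = 1" if "m \<in> ?R" for m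
    using Qs[OF that] Q[OF that] by (simp add: w_def sum_divide_distrib[symmetric] del: sum.cl_ivl_Suc)
  obtain k where k: "k \<in> ?R" "0 < P k i" "0 < P k j"
    using scrambling[OF n c len ij] unfolding P_def by blast
  have K0: "0 < K" using K[OF ij(1) ij(1)] q[OF ij(1)] by (metis less_le_trans zero_less_mult_pos2)
  have low: "(c/2) ^ (n*n) / K \<le> w m k" if m: "m \<in> ?R" "0 < P k m" for m
  proof -
    have "Q m \<le> 2 ^ (n*n) * (K * q k)"
      unfolding Q_def len[symmetric] using K q[OF k(1)] K0 k(1)
      by (intro fold_bisect_le_power[OF c n _ _ m(1)]) auto
    moreover have "c ^ (n*n) \<le> P k m"
      using fold_bisect_unit_mass_lower[OF c, of n bs k m] m(2) len by (simp add: P_def)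
    ultimately have "c ^ (n*n) * Q m \<le> P k m * (2 ^ (n*n) * (K * q k))"
      using P c Q[OF m(1)] by (intro mult_mono) auto
    then show ?thesis using Q[OF m(1)] K0 by (simp add: w_def power_divide field_simps)
  qed
  show ?thesis
    unfolding Q_def[symmetric] x[OF ij(1)] x[OF ij(2)]
    by (rule norm_weighted_diff_le[OF _ k(1)]) (use w0 w1 low k E ij in auto)
qed

text \<open>Since the ratio bound grows only linearly, the contraction factor of block k is at most
  \<open>exp (- C / (k + 1))\<close>. These factors multiply to \<open>exp (- C * harm k)\<close>,
  which tends to 0.\<close>

lemma fold_bisect_shrink:
  fixes X :: "nat \<Rightarrow> 'v::real_normed_vector" and a :: "nat \<Rightarrow> bool"
  assumes n: "1 \<le> n" and c: "0 < c" "c \<le> 1"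
    and q: "\<And>j. j \<in> {1..n+1} \<Longrightarrow> 0 < q j"
    and K: "\<And>t i j. i \<in> {1..n+1} \<Longrightarrow> j \<in> {1..n+1} \<Longrightarrow>
      fold (bisect n c) (map a [0..<t]) q i \<le> (real t + 1) * fold (bisect n c) (map a [0..<t]) q j"
    and e: "0 < e"
  shows "\<exists>t. \<forall>i\<in>{1..n+1}. \<forall>j\<in>{1..n+1}.
     norm (fold (bisect n c) (map a [0..<t]) X i /\<^sub>R fold (bisect n c) (map a [0..<t]) q i
      - fold (bisect n c) (map a [0..<t]) X j /\<^sub>R fold (bisect n c) (map a [0..<t]) q j) < e"
proof -
  let ?R = "{1..n+1}"
  define L where "L = n * n"
  \<comment> \<open>The division by \<open>L\<close> absorbs
    \<open>k * L + 1 \<le> L * (k + 1)\<close>.\<close>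
  define C where "C = (c/2) ^ L / L"
  define Y where "Y t = fold (bisect n c) (map a [0..<t]) X" for t
  define Q where "Q t = fold (bisect n c) (map a [0..<t]) q" for t
  define E where "E = (\<Sum>i\<in>?R. \<Sum>j\<in>?R. norm (X i /\<^sub>R q i - X j /\<^sub>R q j))"
  have L1: "1 \<le> L" using n by (simp add: L_def)
  have C0: "0 < C" using c L1 by (simp add: C_def)
  have E0: "0 \<le> E" unfolding E_def by (intro sum_nonneg) auto
  have "norm (Y (k*L) i /\<^sub>R Q (k*L) i - Y (k*L) j /\<^sub>R Q (k*L) j) \<le> E * exp (- C * harm k)"
    if "i \<in> ?R" "j \<in> ?R" for i j k
    using that
  proof (induction k arbitrary: i j)
    case 0
    have "norm (X i /\<^sub>R q i - X j /\<^sub>R q j) \<le> (\<Sum>j\<in>?R. norm (X i /\<^sub>R q i - X j /\<^sub>R q j))"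
      using 0 by (intro member_le_sum) auto
    also have "\<dots> \<le> E" unfolding E_def
      using 0 by (intro member_le_sum[of i ?R "\<lambda>i. \<Sum>j\<in>?R. norm (X i /\<^sub>R q i - X j /\<^sub>R q j)"])
        (auto intro!: sum_nonneg simp del: sum.cl_ivl_Suc)
    finally show ?case by (simp add: Y_def Q_def harm_def)
  next
    case (Suc k)
    have "[0..<Suc k * L] = [0..<k*L] @ [k*L..<k*L+L]"
      using upt_add_eq_append[of 0 "k*L" L] by (simp only: mult_Suc add.commute[of L] le0)
    then have split: "fold (bisect n c) (map a [0..<Suc k * L]) w
       = fold (bisect n c) (map a [k*L..<k*L+L]) (fold (bisect n c) (map a [0..<k*L]) w)" for w :: "nat \<Rightarrow> 'z::real_vector"
      by (simp only: map_append fold_append comp_apply)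
    have "norm (Y (Suc k*L) i /\<^sub>R Q (Suc k*L) i - Y (Suc k*L) j /\<^sub>R Q (Suc k*L) j)
       \<le> (1 - (c/2) ^ (n*n) / (real (k*L) + 1)) * (E * exp (- C * harm k))"
      unfolding Y_def Q_def split
      by (rule fold_bisect_contraction[OF n c])
        (use Suc K[of _ _ "k*L"] fold_bisect_pos[OF c(1) n, of q] q in \<open>auto simp: L_def[symmetric] Y_def Q_def\<close>)
    also have "1 - (c/2) ^ (n*n) / (real (k*L) + 1) \<le> exp (- C * inverse (Suc k))"
    proof -
      have "real (k*L) + 1 \<le> real L * real (Suc k)" using L1 by (simp add: algebra_simps)
      then have "(c/2)^L / (real L * real (Suc k)) \<le> (c/2)^L / (real (k*L) + 1)"
        using c L1 by (intro divide_left_mono mult_pos_pos) (auto intro!: add_nonneg_pos)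
      moreover have "1 + (- C * inverse (Suc k)) \<le> exp (- C * inverse (Suc k))" by (rule exp_ge_add_one_self)
      moreover have "C * inverse (Suc k) = (c/2)^L / (real L * real (Suc k))" by (simp add: C_def field_simps)
      ultimately show ?thesis by (simp add: L_def)
    qed
    then have "(1 - (c/2) ^ (n*n) / (real (k*L) + 1)) * (E * exp (- C * harm k))
      \<le> exp (- C * inverse (Suc k)) * (E * exp (- C * harm k))"
      using E0 by (intro mult_right_mono) auto
    also have "\<dots> = E * exp (- C * harm (Suc k))"
      by (simp add: harm_Suc exp_add[symmetric] algebra_simps)
    finally show ?case .
  qed
  moreover have "\<exists>k. E * exp (- C * harm k) < e"
  proof -
    have "filterlim (\<lambda>k. C * harm k) at_top sequentially"
      using filterlim_tendsto_pos_mult_at_top[OF tendsto_const C0 harm_at_top] .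
    then have "((\<lambda>k. exp (- (C * harm k))) \<longlongrightarrow> 0) sequentially"
      by (intro filterlim_compose[OF exp_at_bot] filterlim_compose[OF filterlim_uminus_at_bot_at_top])
    then have "((\<lambda>k. E * exp (- (C * harm k))) \<longlongrightarrow> E * 0) sequentially"
      by (intro tendsto_mult tendsto_const)
    then have "\<forall>\<^sub>F k in sequentially. E * exp (- (C * harm k)) < e"
      using e by (intro order_tendstoD) auto
    then show ?thesis by (auto simp: eventually_sequentially)
  qed
  ultimately show ?thesis unfolding Y_def Q_def by (meson le_less_trans)
qed

section \<open>Comparability of the last coordinates under \<open>M\<close>\<close>

definition queue_sorted :: "nat \<Rightarrow> (nat \<Rightarrow> real) \<Rightarrow> bool" where
  "queue_sorted n q \<longleftrightarrow> 0 < q 1 \<and> (\<forall>j\<in>{1..n}. q j \<le> q (Suc j)) \<and> q (n+1) \<le> q 1 + q 2"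

lemma queue_sorted_mono:
  assumes "queue_sorted n q" "1 \<le> i" "i \<le> j" "j \<le> n + 1"
  shows "q i \<le> q j"
  using assms(3,4,2)
proof (induction j rule: dec_induct)
  case (step j)
  then have "q j \<le> q (Suc j)" using assms(1) by (auto simp: queue_sorted_def)
  with step show ?case by simp
qed simp

text \<open>The last clause of \<open>queue_sorted\<close> says that the entry
  \<open>q 1 + q 2\<close> about to join is no smaller than the current last one. It persists
  because neither of the first two entries decreases.\<close>

lemma queue_sorted_bisect:
  assumes "queue_sorted n q" "1 \<le> n"
  shows "queue_sorted n (bisect n 1 b q)"
proof -
  have *: "q 1 \<le> q 2" "0 < q 1" "q (n+1) \<le> q 1 + q 2"
    using assms queue_sorted_mono[OF assms(1), of 1 2] by (auto simp: queue_sorted_def)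
  let ?q = "bisect n 1 b q"
  have first: "q 1 \<le> ?q 1" "?q 1 \<le> q 2" using * by (auto simp: bisect_def)
  have last: "?q (n+1) = q 1 + q 2" using assms(2) by (simp add: bisect_def)
  have mid: "?q j = q (Suc j)" if "j \<noteq> 1" "j \<noteq> n + 1" for j using that by (simp add: bisect_def)
  \<comment> \<open>For \<open>n = 1\<close> position 2 is the last one and receives the new entry
    instead of \<open>q 3\<close>.\<close>
  have two: "q 2 \<le> ?q 2"
    using queue_sorted_mono[OF assms(1), of 2 3] assms(2) * last mid[of 2] by (cases "n = 1") (auto simp: numeral_2_eq_2 numeral_3_eq_3)
  have "?q j \<le> ?q (Suc j)" if j: "j \<in> {1..n}" for j
  proof -
    consider "j = 1" | "j = n" "j \<noteq> 1" | "j \<noteq> 1" "j < n" using j by force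
    then show ?thesis
    proof cases
      case 1
      with first two show ?thesis by (simp add: numeral_2_eq_2)
    next
      case 2
      with * last mid[of j] show ?thesis by simp
    next
      case 3
      with j mid[of j] mid[of "Suc j"] queue_sorted_mono[OF assms(1), of "Suc j" "Suc (Suc j)"]
      show ?thesis by simp
    qed
  qed
  with * first last two show ?thesis by (auto simp: queue_sorted_def)
qed

lemma queue_sorted_fold:
  assumes "queue_sorted n q" "1 \<le> n"
  shows "queue_sorted n (fold (bisect n 1) bs q)"
  using assms by (induction bs arbitrary: q) (simp_all add: queue_sorted_bisect)

text \<open>The champion is the smallest entry and the last one the largest. The new last entry
  exceeds the old one by at most one champion, and the champion never decreases, so their ratio
  grows by at most 1 per step.\<close>

lemma queue_sorted_ratio:
  assumes n: "1 \<le> n" and i: "i \<in> {1..n+1}" and j: "j \<in> {1..n+1}"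
  shows "fold (bisect n 1) bs (\<lambda>_. 1) i \<le> (real (length bs) + 1) * fold (bisect n 1) bs (\<lambda>_. 1) j"
proof -
  let ?q = "\<lambda>bs. fold (bisect n 1) bs (\<lambda>_. 1::real)"
  have s: "queue_sorted n (?q bs)" for bs
    by (rule queue_sorted_fold) (use n in \<open>auto simp: queue_sorted_def\<close>)
  have "?q bs (n+1) \<le> (real (length bs) + 1) * ?q bs 1"
  proof (induction bs rule: rev_induct)
    case (snoc b bs)
    have 2: "?q bs 1 \<le> ?q bs 2" "?q bs 2 \<le> ?q bs (n+1)" "0 < ?q bs 1"
      using queue_sorted_mono[OF s, of 1 2] queue_sorted_mono[OF s, of 2 "n+1"] s[of bs] n
      by (auto simp: queue_sorted_def)
    then have "?q bs 1 + ?q bs 2 \<le> (real (length bs) + 2) * ?q bs 1"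
      using snoc by (simp add: algebra_simps)
    also have "\<dots> \<le> (real (length bs) + 2) * ?q bs (if b then 2 else 1)"
      using 2 by (intro mult_left_mono) auto
    finally show ?case using n by (simp add: fold_bisect_snoc add.commute del: fold_append)
  qed simp
  moreover have "?q bs i \<le> ?q bs (n+1)" "?q bs 1 \<le> ?q bs j"
    using i j by (auto intro!: queue_sorted_mono[OF s])
  moreover from this have "(real (length bs) + 1) * ?q bs 1 \<le> (real (length bs) + 1) * ?q bs j"
    by (intro mult_left_mono) auto
  ultimately show ?thesis by linarith
qed

text \<open>In the tent case the last coordinates all stay 1, so the ratio hypothesis of
  \<open>fold_bisect_shrink\<close> is immediate and every cut halves the volume.\<close>

lemma fold_bisect_half_const:
  "fold (bisect n (1/2)) bs (\<lambda>_. 1::real) = (\<lambda>_. 1)"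
proof (induction bs)
  case (Cons b bs)
  have "bisect n (1/2) b (\<lambda>_. 1::real) = (\<lambda>_. 1)" by (rule ext) (simp add: bisect_def)
  with Cons show ?case by simp
qed simp

section \<open>Homogeneous coordinates\<close>

lemma pos_None: "pos (None :: 'n::{finite,linorder} option) = CARD('n) + 1"
  by (simp add: pos_def)

lemma pos_Some_le: "1 \<le> pos (Some i) \<and> pos (Some i) \<le> CARD('n)" for i :: "'n::{finite,linorder}"
  unfolding pos_def by (auto simp: card_gt_0_iff Suc_le_eq intro!: card_mono)

lemma inj_pos: "inj (pos :: 'n::{finite,linorder} option \<Rightarrow> nat)"
proof (rule injI)
  have Some: "i = j" if "pos (Some i) = pos (Some j)" for i j :: 'n
  proof -
    have "card {..i} < card {..j}" if "i < j" for i j :: 'n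
      using that by (intro psubset_card_mono) auto
    with that show ?thesis by (metis pos_def option.simps(5) less_irrefl neqE)
  qed
  fix k l :: "'n option"
  assume "pos k = pos l"
  moreover have "pos (Some i) \<noteq> pos (None :: 'n option)" for i :: 'n
    using pos_Some_le[of i] by (simp add: pos_None)
  ultimately show "k = l"
    by (cases k; cases l) (metis Some)+
qed

lemma pos_range: "pos k \<in> {1..CARD('n)+1}" for k :: "'n::{finite,linorder} option"
  using pos_Some_le by (cases k) (auto simp: pos_None intro: le_SucI)

lemma bij_pos: "bij_betw pos (UNIV :: 'n::{finite,linorder} option set) {1..CARD('n)+1}"
proof -
  have "range (pos :: 'n option \<Rightarrow> nat) \<subseteq> {1..CARD('n)+1}" using pos_range by blast
  moreover have "card (range (pos :: 'n option \<Rightarrow> nat)) = card {1..CARD('n)+1}"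
    by (simp add: card_image[OF inj_pos])
  ultimately show ?thesis
    using inj_pos by (simp add: bij_betw_def card_subset_eq)
qed

definition idx :: "nat \<Rightarrow> 'n::{finite,linorder} option" where "idx = inv pos"

lemma idx_pos [simp]: "idx (pos k) = k"
  by (simp add: idx_def inj_pos)

lemma pos_idx [simp]: "j \<in> {1..CARD('n)+1} \<Longrightarrow> pos (idx j :: 'n::{finite,linorder} option) = j"
  unfolding idx_def by (metis bij_pos bij_betw_imp_surj_on f_inv_into_f)

lemma eq_idx_iff: "j \<in> {1..CARD('n)+1} \<Longrightarrow> k = idx j \<longleftrightarrow> pos k = j" for k :: "'n::{finite,linorder} option"
  by auto

lemma bij_idx: "bij_betw idx {1..CARD('n)+1} (UNIV :: 'n::{finite,linorder} option set)"
  by (rule bij_betw_byWitness[where f' = pos]) (auto simp: pos_range[simplified])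

lemma sum_idx: "(\<Sum>k\<in>(UNIV::'n::{finite,linorder} option set). f k) = (\<Sum>j=1..CARD('n)+1. f (idx j))"
  by (rule sum.reindex_bij_betw[OF bij_idx, symmetric])

definition vec_of :: "(nat \<Rightarrow> real) \<Rightarrow> real ^ ('n::{finite,linorder} option)" where
  "vec_of u = (\<chi> k. u (pos k))"

lemma mult_vec_of:
  fixes C :: "real ^ ('n::{finite,linorder} option) ^ ('n option)"
  shows "C *v vec_of u = (\<Sum>j=1..CARD('n)+1. u j *\<^sub>R column (idx j) C)"
proof -
  have "C *v vec_of u = (\<Sum>k\<in>UNIV. u (pos k) *\<^sub>R column k C)"
    by (simp add: matrix_mult_sum vec_of_def scalar_mult_eq_scaleR)
  also have "\<dots> = (\<Sum>j=1..CARD('n)+1. u (pos (idx j :: 'n option)) *\<^sub>R column (idx j) C)"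
    by (rule sum_idx)
  also have "\<dots> = (\<Sum>j=1..CARD('n)+1. u j *\<^sub>R column (idx j) C)"
    by (intro sum.cong) auto
  finally show ?thesis .
qed

definition vcol :: "nat \<Rightarrow> real ^ ('n::{finite,linorder} option)" where
  "vcol j = column (idx j) V"

lemma vcol_None: "vcol j $ None = 1"
  by (simp add: vcol_def column_def V_def pos_None)

lemma card_pos: "1 \<le> CARD('n::finite)"
  by (simp add: Suc_le_eq)

text \<open>This ties the matrices of the definitions to \<open>bisect\<close>: each column of a
  digit matrix is a unit vector or \<open>c\<close> times the sum of the first two.\<close>

lemma column_V_digit:
  assumes j: "j \<in> {1..CARD('n)+1}"
  shows "column (idx j) (V ** digit_matrix c a :: real ^ ('n::{finite,linorder} option) ^ ('n option))
     = bisect (CARD('n)) c a vcol j"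
proof -
  let ?D = "digit_matrix c a :: real ^ ('n option) ^ ('n option)"
  have V: "V *v axis (idx i) 1 = (vcol i :: real ^ ('n option))" for i
    by (simp add: matrix_vector_mult_basis vcol_def)
  have ax: "axis (idx i :: 'n option) (1::real) $ k = (if pos k = i then 1 else 0)" if "i \<in> {1..CARD('n)+1}" for i k
    using eq_idx_iff[OF that, of k] by (auto simp: axis_def)
  have "column (idx j) (V ** ?D) = V *v column (idx j) ?D"
    by (simp add: vec_eq_iff column_def matrix_vector_mult_def matrix_matrix_mult_def)
  also have "\<dots> = bisect (CARD('n)) c a vcol j"
  proof -
    have n: "1 \<le> CARD('n)" by (rule card_pos)
    consider "j = 1" | "j = CARD('n) + 1" "j \<noteq> 1" | "j \<noteq> 1" "j \<noteq> CARD('n) + 1" by blast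
    then show ?thesis
    proof cases
      case 1
      have "column (idx j) ?D = axis (idx (if a then 2 else 1)) 1"
        using 1 n j ax[of "if a then 2 else 1"]
        by (auto simp: vec_eq_iff column_def digit_matrix_def)
      then show ?thesis using V 1 by (simp add: bisect_def)
    next
      case 2
      have "column (idx j) ?D = c *\<^sub>R (axis (idx 1) 1 + axis (idx 2) 1)"
        using 2 n j ax[of 1] ax[of 2] by (auto simp: vec_eq_iff column_def digit_matrix_def)
      then show ?thesis using V[of 1] V[of 2] 2
        by (simp add: bisect_def matrix_vector_right_distrib matrix_vector_mult_scaleR)
    next
      case 3
      have "column (idx j) ?D = axis (idx (Suc j)) 1"
        using 3 n j ax[of "Suc j"] by (auto simp: vec_eq_iff column_def digit_matrix_def)
      then show ?thesis using V[of "Suc j"] 3 by (simp add: bisect_def)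
    qed
  qed
  finally show ?thesis .
qed

text \<open>This is the product of \<open>digit_matrix c a\<close> with the column vector
  \<open>u\<close> in numbered coordinates, whereas \<open>bisect\<close> multiplies by that matrix
  from the right. Thus \<open>sum_bisect\<close> expresses associativity.\<close>

definition digit_act :: "nat \<Rightarrow> real \<Rightarrow> bool \<Rightarrow> (nat \<Rightarrow> real) \<Rightarrow> nat \<Rightarrow> real" where
  "digit_act n c a u i = (if i = (if a then 2 else 1) then u 1 else 0)
     + (if i = 1 \<or> i = 2 then c * u (n+1) else 0)
     + (if 3 \<le> i \<and> i \<le> n + 1 then u (i - 1) else 0)"

lemma sum_bisect:
  fixes w :: "nat \<Rightarrow> 'v::real_vector"
  assumes n: "1 \<le> n"
  shows "(\<Sum>j=1..n+1. u j *\<^sub>R bisect n c a w j) = (\<Sum>i=1..n+1. digit_act n c a u i *\<^sub>R w i)"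
proof -
  let ?k = "if a then 2 else 1 :: nat"
  have split: "(\<Sum>j=1..n+1. f j) = f 1 + ((\<Sum>j=2..n. f j) + f (n+1))" for f :: "nat \<Rightarrow> 'v"
    using n by (simp add: sum.atLeast_Suc_atMost[of "Suc 0" n] numeral_2_eq_2)
  have "(\<Sum>j=1..n+1. u j *\<^sub>R bisect n c a w j)
      = u 1 *\<^sub>R w ?k + ((\<Sum>j=2..n. u j *\<^sub>R w (Suc j)) + u (n+1) *\<^sub>R (c *\<^sub>R (w 1 + w 2)))"
  proof -
    have "(\<Sum>j=2..n. u j *\<^sub>R bisect n c a w j) = (\<Sum>j=2..n. u j *\<^sub>R w (Suc j))"
      by (intro sum.cong) (auto simp: bisect_def)
    then show ?thesis unfolding split using n by (simp add: bisect_def)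
  qed
  also have "(\<Sum>j=2..n. u j *\<^sub>R w (Suc j)) = (\<Sum>i=3..n+1. u (i - 1) *\<^sub>R w i)"
    using sum.shift_bounds_cl_Suc_ivl[of "\<lambda>i. u (i - 1) *\<^sub>R w i" 2 n]
    by (simp add: numeral_3_eq_3 numeral_2_eq_2 del: sum.cl_ivl_Suc)
  also have "\<dots> = (\<Sum>i=1..n+1. (if 3 \<le> i \<and> i \<le> n + 1 then u (i - 1) else 0) *\<^sub>R w i)"
    by (intro sum.mono_neutral_cong_left) auto
  also have "u 1 *\<^sub>R w ?k = (\<Sum>i=1..n+1. (if i = ?k then u 1 else 0) *\<^sub>R w i)"
  proof -
    have "(\<Sum>i=1..n+1. (if i = ?k then u 1 else 0) *\<^sub>R w i) = (\<Sum>i\<in>{?k}. u 1 *\<^sub>R w i)"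
      using n by (intro sum.mono_neutral_cong_right) auto
    then show ?thesis by simp
  qed
  also have "u (n+1) *\<^sub>R (c *\<^sub>R (w 1 + w 2)) = (\<Sum>i=1..n+1. (if i = 1 \<or> i = 2 then c * u (n+1) else 0) *\<^sub>R w i)"
  proof -
    have "(\<Sum>i=1..n+1. (if i = 1 \<or> i = 2 then c * u (n+1) else 0) *\<^sub>R w i) = (\<Sum>i\<in>{1,2}. (c * u (n+1)) *\<^sub>R w i)"
      using n by (intro sum.mono_neutral_cong_right) auto
    then show ?thesis by (simp add: scaleR_right_distrib mult.commute)
  qed
  finally show ?thesis
    by (simp add: digit_act_def scaleR_left_distrib sum.distrib add_ac del: sum.cl_ivl_Suc)
qed

lemma digit_act_nonneg:
  assumes "0 \<le> c" "\<And>j. j \<in> {1..n+1} \<Longrightarrow> 0 \<le> u j"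
  shows "0 \<le> digit_act n c a u i"
proof -
  have "0 \<le> u 1" "0 \<le> c * u (n+1)" "3 \<le> i \<and> i \<le> n + 1 \<longrightarrow> 0 \<le> u (i - 1)"
    using assms(1) by (auto intro!: assms(2) mult_nonneg_nonneg)
  then show ?thesis unfolding digit_act_def by simp
qed

lemma digit_act_scale: "digit_act n c a (\<lambda>j. r * u j) i = r * digit_act n c a u i"
  by (simp add: digit_act_def algebra_simps)

text \<open>The two branches agree on the common face because there the coordinate
  opposite to it vanishes.\<close>

lemma digit_act_inj:
  assumes n: "1 \<le> n" and c: "0 < c"
    and u: "\<And>j. j \<in> {1..n+1} \<Longrightarrow> 0 \<le> u j" "\<And>j. j \<in> {1..n+1} \<Longrightarrow> 0 \<le> u' j"
    and eq: "\<And>i. i \<in> {1..n+1} \<Longrightarrow> digit_act n c a u i = digit_act n c a' u' i"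
    and j: "j \<in> {1..n+1}"
  shows "u j = u' j"
proof -
  have e: "digit_act n c a u 1 = digit_act n c a' u' 1" "digit_act n c a u 2 = digit_act n c a' u' 2"
    using eq[of 1] eq[of 2] n by auto
  \<comment> \<open>Whatever the digit, \<open>c * u (n+1)\<close> is the smaller of the first two
    values and \<open>u 1\<close> is their distance; this needs the signs.\<close>
  have "0 \<le> u 1" "0 \<le> u' 1" using u n by auto
  with e have 1: "u 1 = u' 1 \<and> c * u (n+1) = c * u' (n+1)"
    by (cases a; cases a') (auto simp: digit_act_def)
  then have 2: "u (n+1) = u' (n+1)" using c by simp
  have "u j = u' j" if "j \<noteq> 1" "j \<noteq> n+1"
    using eq[of "Suc j"] j that by (cases a; cases a') (auto simp: digit_act_def)
  with 1 2 show ?thesis by blast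
qed

text \<open>Row \<open>n + 2 - m\<close> of \<open>V\<close> yields the partial sum of the
  coordinates 2 to m. Differences of consecutive sums kill these coordinates, and the last row then
  kills the first.\<close>

lemma V_ker:
  fixes x :: "real ^ ('n::{finite,linorder} option)"
  assumes "V *v x = 0"
  shows "x = 0"
proof -
  define f where "f j = x $ idx j" for j
  have x: "x = vec_of f" by (simp add: vec_of_def f_def vec_eq_iff)
  have row: "(\<Sum>j=1..CARD('n)+1. f j * V $ k $ idx j) = 0" for k :: "'n option"
    using arg_cong[OF assms, of "\<lambda>v. v $ k"]
    by (simp add: x mult_vec_of column_def del: sum.cl_ivl_Suc)
  have z: "(\<Sum>j=2..m. f j) = 0" if m: "m \<in> {2..CARD('n)+1}" for m
  proof -
    let ?k = "idx (CARD('n) + 2 - m) :: 'n option"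
    have "pos ?k = CARD('n) + 2 - m" using m by (intro pos_idx) auto
    then have "(\<Sum>j=1..CARD('n)+1. f j * V $ ?k $ idx j) = (\<Sum>j=2..m. f j)"
      using m by (intro sum.mono_neutral_cong_right) (auto simp: V_def)
    with row show ?thesis by simp
  qed
  have f2: "f m = 0" if m: "m \<in> {2..CARD('n)+1}" for m
  proof (cases "m = 2")
    case True
    with z[OF m] show ?thesis by simp
  next
    case False
    then have "(\<Sum>j=2..m. f j) = (\<Sum>j=2..m-1. f j) + f m"
      using m sum.cl_ivl_Suc[of f 2 "m - 1"] by auto
    moreover have "m - 1 \<in> {2..CARD('n)+1}" using m False by auto
    ultimately show ?thesis using z[OF m] z[of "m - 1"] by linarith
  qed
  have "(\<Sum>j=1..CARD('n)+1. f j * V $ (None :: 'n option) $ idx j) = (\<Sum>j\<in>{1}. f j)"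
    using f2 by (intro sum.mono_neutral_cong_right) (auto simp: V_def pos_None)
  then have "f 1 = 0" using row by simp
  with f2 have "f j = 0" if "j \<in> {1..CARD('n)+1}" for j
    using that by (cases "j = 1") auto
  with pos_range[where 'n='n] show ?thesis by (simp add: x vec_of_def vec_eq_iff)
qed

lemma invertible_V: "invertible (V :: real ^ ('n::{finite,linorder} option) ^ ('n option))"
  using V_ker unfolding invertible_left_inverse matrix_left_invertible_ker by blast

lemma vcol_indep:
  assumes "(\<Sum>j=1..CARD('n)+1. u j *\<^sub>R vcol j) = (\<Sum>j=1..CARD('n)+1. u' j *\<^sub>R vcol j :: real ^ ('n::{finite,linorder} option))"
    and j: "j \<in> {1..CARD('n)+1}"
  shows "u j = u' j"
proof -
  have "V *v (vec_of u - vec_of u' :: real ^ ('n option)) = 0"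
    using assms(1) by (simp add: matrix_vector_mult_diff_distrib mult_vec_of vcol_def del: sum.cl_ivl_Suc)
  then have "vec_of u = (vec_of u' :: real ^ ('n option))" using V_ker by fastforce
  then have "u (pos (idx j :: 'n option)) = u' (pos (idx j :: 'n option))"
    by (metis vec_of_def vec_lambda_beta)
  with j show ?thesis by simp
qed

lemma sum_digit_columns:
  "(V ** digit_matrix c a :: real ^ ('n::{finite,linorder} option) ^ ('n option)) *v vec_of u
     = (\<Sum>j=1..CARD('n)+1. u j *\<^sub>R bisect (CARD('n)) c a vcol j)"
  unfolding mult_vec_of by (intro sum.cong refl) (simp only: column_V_digit)

lemma invertible_digit_matrix:
  assumes "0 < c"
  shows "invertible (digit_matrix c a :: real ^ ('n::{finite,linorder} option) ^ ('n option))"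
proof -
  have "x = 0" if x: "digit_matrix c a *v x = (0 :: real ^ ('n option))" for x :: "real ^ ('n option)"
  proof -
    define f where "f j = x $ idx j" for j
    have xf: "x = vec_of f" by (simp add: vec_of_def f_def vec_eq_iff)
    have n: "1 \<le> CARD('n)" by (rule card_pos)
    have "(\<Sum>j=1..CARD('n)+1. digit_act (CARD('n)) c a f j *\<^sub>R vcol j) = (V ** digit_matrix c a) *v x"
      unfolding xf sum_digit_columns sum_bisect[OF n] ..
    also have "\<dots> = (\<Sum>j=1..CARD('n)+1. 0 *\<^sub>R (vcol j :: real ^ ('n option)))"
      using x by (simp add: matrix_vector_mul_assoc[symmetric])
    finally have a0: "digit_act (CARD('n)) c a f j = 0" if "j \<in> {1..CARD('n)+1}" for j
      using that by (rule vcol_indep)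
    have "f 1 = 0 \<and> f (CARD('n)+1) = 0"
      using a0[of 1] a0[of 2] n assms by (cases a) (auto simp: digit_act_def)
    moreover have "f j = 0" if "j \<in> {2..CARD('n)}" for j
      using a0[of "Suc j"] that by (auto simp: digit_act_def split: if_splits)
    ultimately have "f j = 0" if "j \<in> {1..CARD('n)+1}" for j
      using that by (cases "j = 1"; cases "j = CARD('n)+1") auto
    with pos_range[where 'n='n] show ?thesis by (simp add: xf vec_of_def vec_eq_iff)
  qed
  then show ?thesis unfolding invertible_left_inverse matrix_left_invertible_ker by blast
qed

section \<open>Simplices as sections of cones\<close>

definition hom_simplex :: "(nat \<Rightarrow> real ^ ('n::{finite,linorder} option)) \<Rightarrow> (real ^ 'n::{finite,linorder}) set" where
  "hom_simplex W = convex hull ((\<lambda>j. proj_point (W j)) ` {1..CARD('n)+1})"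

lemma proj_simplex_eq: "proj_simplex C = hom_simplex (\<lambda>j. column (idx j) C)"
  for C :: "real ^ ('n::{finite,linorder} option) ^ ('n option)"
proof -
  have "(\<lambda>j. proj_point (column (idx j) C)) ` {1..CARD('n)+1} = (\<lambda>k. proj_point (column k C)) ` idx ` {1..CARD('n)+1}"
    by (simp only: image_image)
  also have "\<dots> = range (\<lambda>k. proj_point (column k C))"
    by (simp only: bij_betw_imp_surj_on[OF bij_idx])
  finally show ?thesis by (simp only: hom_simplex_def proj_simplex_def)
qed

lemma hom_coords_None [simp]: "hom_coords x $ None = 1"
  by (simp add: hom_coords_def)

lemma hom_coords_Some [simp]: "hom_coords x $ Some i = x $ i"
  by (simp add: hom_coords_def)

lemma hom_proj_point: "w $ None \<noteq> 0 \<Longrightarrow> hom_coords (proj_point w) = w /\<^sub>R w $ None"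
  by (simp add: vec_eq_iff hom_coords_def proj_point_def divide_inverse mult.commute split: option.split)

text \<open>Cone coefficients \<open>u j\<close> become barycentric weights
  \<open>u j * W j $ None\<close>, which add up to 1 by the last coordinate. In the cone the
  vertices need no normalization and the digit matrices act linearly.\<close>

lemma mem_hom_simplex_iff:
  fixes W :: "nat \<Rightarrow> real ^ ('n::{finite,linorder} option)"
  assumes W: "\<And>j. j \<in> {1..CARD('n)+1} \<Longrightarrow> 0 < W j $ None"
  shows "x \<in> hom_simplex W \<longleftrightarrow> (\<exists>u. (\<forall>j\<in>{1..CARD('n)+1}. 0 \<le> u j) \<and> hom_coords x = (\<Sum>j=1..CARD('n)+1. u j *\<^sub>R W j))"
proof
  let ?R = "{1..CARD('n)+1}"
  let ?T = "{x. \<exists>u. (\<forall>j\<in>?R. 0 \<le> u j) \<and> hom_coords x = (\<Sum>j\<in>?R. u j *\<^sub>R W j)}"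
  assume "x \<in> hom_simplex W"
  moreover have "hom_simplex W \<subseteq> ?T"
    unfolding hom_simplex_def
  proof (rule hull_minimal)
    show "(\<lambda>j. proj_point (W j)) ` ?R \<subseteq> ?T"
    proof safe
      fix j assume j: "j \<in> ?R"
      let ?u = "\<lambda>i. if i = j then inverse (W j $ None) else 0"
      have "(\<Sum>i\<in>?R. ?u i *\<^sub>R W i) = (\<Sum>i\<in>{j}. inverse (W j $ None) *\<^sub>R W i)"
        using j by (intro sum.mono_neutral_cong_right) auto
      also have "\<dots> = W j /\<^sub>R W j $ None" by simp
      also have "\<dots> = hom_coords (proj_point (W j))"
        using W[OF j] by (intro hom_proj_point[symmetric]) simp
      finally have "hom_coords (proj_point (W j)) = (\<Sum>i\<in>?R. ?u i *\<^sub>R W i)" ..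
      moreover have "\<forall>i\<in>?R. 0 \<le> ?u i" using W[OF j] by simp
      ultimately show "\<exists>u. (\<forall>j\<in>?R. 0 \<le> u j) \<and> hom_coords (proj_point (W j)) = (\<Sum>j\<in>?R. u j *\<^sub>R W j)"
        by (intro exI[of _ ?u] conjI)
    qed
    show "convex ?T"
    proof (rule convexI, safe)
      fix x y and s t :: real and u v
      assume st: "0 \<le> s" "0 \<le> t" "s + t = 1"
        and u: "\<forall>j\<in>?R. 0 \<le> u j" "hom_coords x = (\<Sum>j\<in>?R. u j *\<^sub>R W j)"
        and v: "\<forall>j\<in>?R. 0 \<le> v j" "hom_coords y = (\<Sum>j\<in>?R. v j *\<^sub>R W j)"
      have "hom_coords (s *\<^sub>R x + t *\<^sub>R y) = s *\<^sub>R hom_coords x + t *\<^sub>R hom_coords y"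
        using st by (simp add: vec_eq_iff hom_coords_def split: option.split)
      also have "\<dots> = (\<Sum>j\<in>?R. (s * u j + t * v j) *\<^sub>R W j)"
        unfolding u v by (simp add: scaleR_left_distrib sum.distrib scaleR_sum_right del: sum.cl_ivl_Suc)
      finally show "\<exists>w. (\<forall>j\<in>?R. 0 \<le> w j) \<and> hom_coords (s *\<^sub>R x + t *\<^sub>R y) = (\<Sum>j\<in>?R. w j *\<^sub>R W j)"
        using st u(1) v(1) by (intro exI[of _ "\<lambda>j. s * u j + t * v j"] conjI) auto
    qed
  qed
  ultimately show "\<exists>u. (\<forall>j\<in>?R. 0 \<le> u j) \<and> hom_coords x = (\<Sum>j\<in>?R. u j *\<^sub>R W j)" by blast
next
  let ?R = "{1..CARD('n)+1}"
  assume "\<exists>u. (\<forall>j\<in>?R. 0 \<le> u j) \<and> hom_coords x = (\<Sum>j\<in>?R. u j *\<^sub>R W j)"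
  then obtain u where u: "\<forall>j\<in>?R. 0 \<le> u j" "hom_coords x = (\<Sum>j\<in>?R. u j *\<^sub>R W j)" by blast
  have W': "W j $ None \<noteq> 0" if "j \<in> ?R" for j using W[OF that] by simp
  have "x = (\<Sum>j\<in>?R. (u j * W j $ None) *\<^sub>R proj_point (W j))"
  proof -
    have "x $ i = (\<Sum>j\<in>?R. (u j * W j $ None) *\<^sub>R proj_point (W j)) $ i" for i
    proof -
      have "x $ i = (\<Sum>j\<in>?R. u j * W j $ Some i)"
        using arg_cong[OF u(2), of "\<lambda>v. v $ Some i"] by (simp del: sum.cl_ivl_Suc)
      also have "\<dots> = (\<Sum>j\<in>?R. (u j * W j $ None) *\<^sub>R proj_point (W j)) $ i"
        unfolding sum_component by (intro sum.cong refl) (simp add: proj_point_def W')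
      finally show ?thesis .
    qed
    then show ?thesis by (simp add: vec_eq_iff)
  qed
  moreover have "(\<Sum>j\<in>?R. (u j * W j $ None) *\<^sub>R proj_point (W j)) \<in> hom_simplex W"
    unfolding hom_simplex_def
  proof (rule convex_sum[OF _ convex_convex_hull])
    show "(\<Sum>j\<in>?R. u j * W j $ None) = 1"
      using arg_cong[OF u(2), of "\<lambda>v. v $ None"] by (simp del: sum.cl_ivl_Suc)
    show "0 \<le> u j * W j $ None" if "j \<in> ?R" for j
      using u(1) W[OF that] that by (intro mult_nonneg_nonneg) auto
    show "proj_point (W j) \<in> convex hull (\<lambda>j. proj_point (W j)) ` ?R" if "j \<in> ?R" for j
      using that by (intro hull_inc imageI)
  qed simp
  ultimately show "x \<in> hom_simplex W" by argo
qed

section \<open>Decay of the affinity\<close>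

text \<open>The new vertex is the mean of the first two, weighted by their last coordinates. The
  share of the volume that a piece receives is the weight of the vertex replaced in it.\<close>

definition ratio :: "(nat \<Rightarrow> real) \<Rightarrow> bool \<Rightarrow> real" where
  "ratio q b = (if b then q 1 else q 2) / (q 1 + q 2)"

fun volume_ratio :: "nat \<Rightarrow> real \<Rightarrow> (nat \<Rightarrow> real) \<Rightarrow> bool list \<Rightarrow> real" where
  "volume_ratio n c q [] = 1"
| "volume_ratio n c q (b # bs) = ratio q b * volume_ratio n c (bisect n c b q) bs"

text \<open>The recursion peels off the first digit, as \<open>affinity\<close> does, but the cut
  made last belongs to the last digit, which is the form needed for volumes.\<close>

lemma volume_ratio_snoc:
  "volume_ratio n c q (bs @ [b]) = volume_ratio n c q bs * ratio (fold (bisect n c) bs q) b"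
  by (induction bs arbitrary: q) auto

lemma volume_ratio_half: "volume_ratio n (1/2) (\<lambda>_. 1) bs = (1/2) ^ length bs"
proof (induction bs)
  case (Cons b bs)
  have "bisect n (1/2) b (\<lambda>_. 1::real) = (\<lambda>_. 1)" using fold_bisect_half_const[of n "[b]"] by simp
  with Cons show ?case by (simp add: ratio_def)
qed simp

lemma volume_ratio_nonneg:
  assumes "queue_sorted n q" "1 \<le> n"
  shows "0 \<le> volume_ratio n 1 q bs"
  using assms
proof (induction bs arbitrary: q)
  case (Cons b bs)
  have "0 < q 1" "0 < q 2"
    using Cons.prems queue_sorted_mono[OF Cons.prems(1), of 1 2] by (auto simp: queue_sorted_def)
  then have "0 \<le> ratio q b" by (simp add: ratio_def)
  with Cons queue_sorted_bisect show ?case by simp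
qed simp

text \<open>The Hellinger affinity of the two measures giving a cylinder of rank \<open>t\<close> its
  Lebesgue measure under the two maps.\<close>

fun affinity :: "nat \<Rightarrow> nat \<Rightarrow> (nat \<Rightarrow> real) \<Rightarrow> real" where
  "affinity n 0 q = 1"
| "affinity n (Suc t) q = (\<Sum>b\<in>UNIV. sqrt (ratio q b / 2) * affinity n t (bisect n 1 b q))"

lemma sum_lists_Suc:
  "(\<Sum>bs\<in>{bs::bool list. length bs = Suc t}. f bs) = (\<Sum>b\<in>UNIV. \<Sum>bs\<in>{bs. length bs = t}. f (b # bs))"
proof -
  have "{bs::bool list. length bs = Suc t} = (\<lambda>(b, bs). b # bs) ` (UNIV \<times> {bs. length bs = t})"
    by (auto simp: length_Suc_conv image_iff)
  moreover have "inj_on (\<lambda>(b, bs). b # bs) (UNIV \<times> {bs::bool list. length bs = t})"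
    by (auto simp: inj_on_def)
  ultimately show ?thesis
    by (simp add: sum.reindex sum.cartesian_product case_prod_unfold)
qed

lemma affinity_eq_sum:
  "affinity n t q = (\<Sum>bs\<in>{bs. length bs = t}. sqrt ((1/2) ^ t * volume_ratio n 1 q bs))"
proof (induction t arbitrary: q)
  case (Suc t)
  have "sqrt (ratio q b / 2) * sqrt ((1/2) ^ t * volume_ratio n 1 (bisect n 1 b q) bs)
      = sqrt ((1/2) ^ Suc t * volume_ratio n 1 q (b # bs))" for b bs
    by (simp add: real_sqrt_mult[symmetric] algebra_simps)
  then show ?case by (simp add: sum_lists_Suc Suc sum_distrib_left)
qed simp

lemma affinity_nonneg:
  assumes "queue_sorted n q" "1 \<le> n"
  shows "0 \<le> affinity n t q"
  unfolding affinity_eq_sum using volume_ratio_nonneg[OF assms] by (intro sum_nonneg) auto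

text \<open>With \<open>x = q 2 / q 1\<close> the square of the sum is
  \<open>1/2 + sqrt (x / (1 + x)^2)\<close>, and \<open>x / (1 + x)^2\<close> decreases for
  \<open>x \<ge> 1\<close>. For \<theta> = 1 the bound is 1.\<close>

lemma sqrt_ratio_sum:
  assumes "0 < q 1" "1 \<le> \<theta>" "\<theta> * q 1 \<le> q 2"
  shows "(\<Sum>b\<in>UNIV. sqrt (ratio q b / 2)) \<le> sqrt (1/2 + sqrt (\<theta> / (1 + \<theta>)^2))"
proof -
  have q2: "0 < q 2" using assms by (smt (verit) mult_le_cancel_right1)
  define x where "x = q 2 / q 1"
  have x: "\<theta> \<le> x" "0 < x" using assms q2 by (simp_all add: x_def field_simps)
  have r: "ratio q True = 1 / (1 + x)" "ratio q False = x / (1 + x)"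
    using assms(1) q2 by (simp_all add: ratio_def x_def field_simps)
  \<comment> \<open>The product is the difference of the two sides of the next inequality.\<close>
  have "0 \<le> (x - \<theta>) * (\<theta> * x - 1)"
    using x assms(2) by (intro mult_nonneg_nonneg) (smt (verit) mult_le_cancel_left1 mult_less_cancel_left1)+
  then have "x * (1 + \<theta>)^2 \<le> \<theta> * (1 + x)^2"
    by (simp add: power2_eq_square algebra_simps)
  then have le: "x / (1 + x)^2 \<le> \<theta> / (1 + \<theta>)^2"
    using x assms(2) by (simp add: field_simps)
  have s2: "(sqrt (1 / (1 + x) / 2) + sqrt (x / (1 + x) / 2))^2 = 1/2 + sqrt (x / (1 + x)^2)"
  proof -
    have "sqrt (1 / (1 + x) / 2) * sqrt (x / (1 + x) / 2) = sqrt (x / (1 + x)^2 / 2^2)"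
      by (simp add: real_sqrt_mult[symmetric] power2_eq_square algebra_simps)
    also have "\<dots> = sqrt (x / (1 + x)^2) / 2" by (simp only: real_sqrt_divide) simp
    finally have "sqrt (1 / (1 + x) / 2) * sqrt (x / (1 + x) / 2) = sqrt (x / (1 + x)^2) / 2" .
    moreover have "1 / (1 + x) / 2 + x / (1 + x) / 2 = 1 / 2" using x by (simp add: field_simps)
    ultimately show ?thesis using x by (simp add: power2_sum algebra_simps)
  qed
  have "(\<Sum>b\<in>UNIV. sqrt (ratio q b / 2)) = sqrt (1 / (1 + x) / 2) + sqrt (x / (1 + x) / 2)"
    by (simp add: UNIV_bool r)
  also have "\<dots> \<le> sqrt (1/2 + sqrt (x / (1 + x)^2))"
    by (rule real_le_rsqrt) (simp only: s2)
  also have "\<dots> \<le> sqrt (1/2 + sqrt (\<theta> / (1 + \<theta>)^2))"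
    using le by (simp del: real_sqrt_divide)
  finally show ?thesis .
qed

lemma sqrt_ratio_sum_le_1:
  assumes "queue_sorted n q" "1 \<le> n"
  shows "(\<Sum>b\<in>UNIV. sqrt (ratio q b / 2)) \<le> 1"
proof -
  have "0 < q 1" "q 1 \<le> q 2"
    using assms queue_sorted_mono[OF assms(1), of 1 2] by (auto simp: queue_sorted_def)
  from sqrt_ratio_sum[of q 1] this show ?thesis by (simp add: real_sqrt_divide)
qed

text \<open>A bounded stopping time: along every digit sequence one of the first \<open>k\<close>
  states, the present one included, has front ratio at least \<theta>.\<close>

fun reaches_unbalanced :: "nat \<Rightarrow> real \<Rightarrow> nat \<Rightarrow> (nat \<Rightarrow> real) \<Rightarrow> bool" where
  "reaches_unbalanced n \<theta> 0 q = False"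
| "reaches_unbalanced n \<theta> (Suc k) q = (\<theta> * q 1 \<le> q 2 \<or> (\<forall>b. reaches_unbalanced n \<theta> k (bisect n 1 b q)))"

text \<open>While the front ratio is below \<theta>, the champion grows by a factor at most \<theta>
  per step. The entry at position \<open>k + 2\<close> meanwhile advances unchanged, and on reaching
  position 2 it is still at least \<theta> times the champion.\<close>

lemma reaches_unbalanced_queue:
  assumes "queue_sorted n q" "1 \<le> n" "1 \<le> \<theta>" "k + 2 \<le> n + 1" "\<theta> ^ Suc k * q 1 \<le> q (k + 2)"
  shows "reaches_unbalanced n \<theta> (Suc k) q"
  using assms
proof (induction k arbitrary: q)
  case 0
  then show ?case by (simp add: numeral_2_eq_2)
next
  case (Suc k)
  show ?case
  proof (cases "\<theta> * q 1 \<le> q 2")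
    case False
    have "reaches_unbalanced n \<theta> (Suc k) (bisect n 1 b q)" for b
    proof (rule Suc.IH)
      have "bisect n 1 b q 1 \<le> \<theta> * q 1"
        using False Suc.prems by (auto simp: bisect_def queue_sorted_def)
      then have "\<theta> ^ Suc k * bisect n 1 b q 1 \<le> \<theta> ^ Suc k * (\<theta> * q 1)"
        using Suc.prems by (intro mult_left_mono) auto
      also have "\<dots> \<le> q (Suc k + 2)" using Suc.prems by (simp add: algebra_simps)
      also have "\<dots> = bisect n 1 b q (k + 2)" using Suc.prems by (simp add: bisect_def)
      finally show "\<theta> ^ Suc k * bisect n 1 b q 1 \<le> bisect n 1 b q (k + 2)" .
    qed (use Suc.prems queue_sorted_bisect in auto)
    then show ?thesis by simp
  qed simp
qed

text \<open>If the two front entries stayed balanced for \<open>n + 1\<close> steps, then the entry created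
  in the first step, which is at least twice the champion, would meet a champion of
  the same size.\<close>

lemma reaches_unbalanced_all:
  assumes q: "queue_sorted n q" and n: "1 \<le> n" and \<theta>: "1 \<le> \<theta>" "\<theta> ^ Suc n \<le> 2"
  shows "reaches_unbalanced n \<theta> (Suc n) q"
proof (cases "\<theta> * q 1 \<le> q 2")
  case False
  have 12: "0 < q 1" "q 1 \<le> q 2"
    using q n queue_sorted_mono[OF q, of 1 2] by (auto simp: queue_sorted_def)
  have "reaches_unbalanced n \<theta> n (bisect n 1 b q)" for b
  proof -
    have "bisect n 1 b q 1 \<le> \<theta> * q 1"
      using False 12 \<theta>(1) by (auto simp: bisect_def)
    then have "\<theta> ^ n * bisect n 1 b q 1 \<le> \<theta> ^ n * (\<theta> * q 1)"
      using \<theta> by (intro mult_left_mono) auto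
    also have "\<dots> \<le> 2 * q 1" using \<theta>(2) 12 by (simp add: algebra_simps)
    also have "\<dots> \<le> bisect n 1 b q (n + 1)" using 12 n by (simp add: bisect_def)
    finally have "\<theta> ^ n * bisect n 1 b q 1 \<le> bisect n 1 b q (n + 1)" .
    with reaches_unbalanced_queue[OF queue_sorted_bisect[OF q n] n \<theta>(1), of "n - 1"] n show ?thesis by simp
  qed
  then show ?thesis by simp
qed simp

text \<open>The weights of a step add up to at most 1, so further steps cannot raise a bound that is
  uniform over all sorted queues.\<close>

lemma affinity_mono:
  assumes n: "1 \<le> n" and B: "\<And>q. queue_sorted n q \<Longrightarrow> affinity n t q \<le> B" and q: "queue_sorted n q"
  shows "affinity n (k + t) q \<le> B"
  using q
proof (induction k arbitrary: q)
  case (Suc k)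
  have B0: "0 \<le> B" using Suc.prems affinity_nonneg[OF _ n] B by (meson order_trans)
  have "affinity n (Suc k + t) q \<le> (\<Sum>b\<in>UNIV. sqrt (ratio q b / 2) * B)"
    using Suc queue_sorted_bisect[OF Suc.prems n] queue_sorted_mono[OF Suc.prems, of 1 2] n
    by (auto intro!: sum_mono mult_left_mono simp: ratio_def queue_sorted_def)
  also have "\<dots> \<le> 1 * B"
    unfolding sum_distrib_right[symmetric]
    by (intro mult_right_mono sqrt_ratio_sum_le_1[OF Suc.prems n] B0)
  finally show ?case by simp
qed (use B in auto)

text \<open>Each branch passes an unbalanced state, where a factor \<open>h\<close> is gained; by
  \<open>sqrt_ratio_sum_le_1\<close> the steps before and after it cost nothing.\<close>

lemma affinity_reaches_unbalanced:
  assumes n: "1 \<le> n" and \<theta>: "1 \<le> \<theta>"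
    and B: "\<And>q. queue_sorted n q \<Longrightarrow> affinity n t q \<le> B"
    and q: "queue_sorted n q" "reaches_unbalanced n \<theta> k q"
    and h: "h = sqrt (1/2 + sqrt (\<theta> / (1 + \<theta>)^2))"
  shows "affinity n (k + t) q \<le> h * B"
  using q
proof (induction k arbitrary: q)
  case (Suc k)
  have q12: "0 < q 1" "q 1 \<le> q 2"
    using Suc.prems queue_sorted_mono[OF Suc.prems(1), of 1 2] n by (auto simp: queue_sorted_def)
  then have r: "0 \<le> ratio q b" for b by (simp add: ratio_def)
  have B0: "0 \<le> B" using Suc.prems affinity_nonneg[OF _ n] B by (meson order_trans)
  have h0: "0 \<le> h" using \<theta> h by simp
  note qs = queue_sorted_bisect[OF Suc.prems(1) n]
  show ?case
  proof (cases "\<theta> * q 1 \<le> q 2")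
    case True
    have "affinity n (Suc k + t) q \<le> (\<Sum>b\<in>UNIV. sqrt (ratio q b / 2) * B)"
      using affinity_mono[OF n B qs] r by (auto intro!: sum_mono mult_left_mono)
    also have "\<dots> \<le> h * B"
      unfolding sum_distrib_right[symmetric] h using q12 \<theta> True
      by (intro mult_right_mono sqrt_ratio_sum B0)
    finally show ?thesis .
  next
    case False
    have "affinity n (Suc k + t) q \<le> (\<Sum>b\<in>UNIV. sqrt (ratio q b / 2) * (h * B))"
      using Suc.IH[OF qs] Suc.prems(2) False r by (auto intro!: sum_mono mult_left_mono)
    also have "\<dots> \<le> 1 * (h * B)"
      unfolding sum_distrib_right[symmetric]
      by (intro mult_right_mono sqrt_ratio_sum_le_1[OF Suc.prems(1) n] mult_nonneg_nonneg h0 B0)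
    finally show ?thesis by simp
  qed
qed auto

lemma affinity_decay:
  assumes n: "1 \<le> n"
  obtains h where "0 \<le> h" "h < 1" "\<And>k q. queue_sorted n q \<Longrightarrow> affinity n (k * (n+1)) q \<le> h ^ k"
proof -
  \<comment> \<open>The root is the largest value that \<open>reaches_unbalanced_all\<close> admits;
    all that \<open>h < 1\<close> requires is that it exceeds 1.\<close>
  define \<theta> :: real where "\<theta> = root (Suc n) 2"
  have \<theta>: "1 < \<theta>" "\<theta> ^ Suc n = 2" by (simp_all add: \<theta>_def del: power_Suc)
  define h where "h = sqrt (1/2 + sqrt (\<theta> / (1 + \<theta>)^2))"
  have "\<theta> / (1 + \<theta>)^2 < (1/2)^2"
  proof -
    have "0 < (\<theta> - 1)^2" using \<theta> by simp
    then have "4 * \<theta> < (1 + \<theta>)^2" by (simp add: power2_eq_square algebra_simps)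
    then show ?thesis using \<theta> by (simp add: field_simps)
  qed
  then have "sqrt (\<theta> / (1 + \<theta>)^2) < 1/2" by (rule real_less_lsqrt[rotated -1]) (use \<theta> in auto)
  then have "h < 1" by (simp add: h_def)
  moreover have "0 \<le> h" using \<theta> by (simp add: h_def)
  moreover have "affinity n (k * (n+1)) q \<le> h ^ k" if "queue_sorted n q" for k q
    using that
  proof (induction k arbitrary: q)
    case (Suc k)
    have "affinity n (Suc n + k * (n+1)) q \<le> h * h ^ k"
      by (rule affinity_reaches_unbalanced[OF n _ Suc.IH Suc.prems reaches_unbalanced_all[OF Suc.prems n] h_def]) (use \<theta> in auto)
    moreover have "Suc k * (n+1) = Suc n + k * (n+1)" by simp
    ultimately show ?case by (simp only: power_Suc)
  qed simp
  ultimately show thesis using that by blast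
qed

section \<open>Cylinders\<close>

lemma matrix_inv_right: "invertible A \<Longrightarrow> A ** matrix_inv A = mat 1"
  and matrix_inv_left: "invertible A \<Longrightarrow> matrix_inv A ** A = mat 1"
  for A :: "real ^ 'm ^ 'm"
  unfolding matrix_inv_def invertible_def by (metis (mono_tags, lifting) someI_ex)+

lemma column_vertices_None:
  "fold (bisect n c) bs vcol j $ None = fold (bisect n c) bs (\<lambda>_. 1) j"
  using linear_fold_bisect[of "\<lambda>w :: real ^ ('n::{finite,linorder} option). w $ None" n c bs vcol j]
  by (simp add: vcol_None linearI)

lemma vertices_None_pos:
  assumes "0 < c" "j \<in> {1..CARD('n)+1}"
  shows "0 < (fold (bisect (CARD('n)) c) bs vcol j :: real ^ ('n::{finite,linorder} option)) $ None"
  unfolding column_vertices_None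
  by (rule fold_bisect_pos[OF assms(1) card_pos _ assms(2)]) simp

lemma Delta_eq_hom_simplex: "Delta = hom_simplex vcol"
  by (simp only: Delta_def proj_simplex_eq vcol_def[abs_def])

lemma mem_Delta_iff:
  fixes x :: "real ^ 'n::{finite,linorder}"
  shows "x \<in> Delta \<longleftrightarrow> (\<exists>u. (\<forall>j\<in>{1..CARD('n)+1}. 0 \<le> u j) \<and> hom_coords x = (\<Sum>j=1..CARD('n)+1. u j *\<^sub>R vcol j))"
  unfolding Delta_eq_hom_simplex by (rule mem_hom_simplex_iff) (simp add: vcol_None)

lemma mem_DeltaE:
  fixes x :: "real ^ 'n::{finite,linorder}"
  assumes "x \<in> Delta"
  obtains u where "\<forall>j\<in>{1..CARD('n)+1}. 0 \<le> u j" "hom_coords x = (\<Sum>j=1..CARD('n)+1. u j *\<^sub>R vcol j)"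
  using assms unfolding mem_Delta_iff by (elim exE conjE) (rule that)

lemma mem_DeltaI:
  fixes x :: "real ^ 'n::{finite,linorder}"
  assumes "\<forall>j\<in>{1..CARD('n)+1}. 0 \<le> u j" "hom_coords x = (\<Sum>j=1..CARD('n)+1. u j *\<^sub>R vcol j)"
  shows "x \<in> Delta"
  unfolding mem_Delta_iff by (rule exI[of _ u]) (rule conjI[OF assms])

text \<open>Scaling the last column of the digit matrix is compensated by the last coordinate of
  \<open>u\<close>. Hence the pieces \<open>Delta_digit\<close>, defined with \<open>c = 1\<close>,
  serve the tent map as well.\<close>

lemma digit_act_rescale:
  assumes "1 \<le> n" "0 < c'"
  shows "digit_act n c' a (u(n+1 := u (n+1) * c / c')) i = digit_act n c a u i"
  using assms by (auto simp: digit_act_def)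

lemma sum_bisect_rescale:
  fixes w :: "nat \<Rightarrow> 'v::real_vector"
  assumes "1 \<le> n" "0 < c'"
  shows "(\<Sum>j=1..n+1. (u(n+1 := u (n+1) * c / c')) j *\<^sub>R bisect n c' a w j) = (\<Sum>j=1..n+1. u j *\<^sub>R bisect n c a w j)"
  unfolding sum_bisect[OF assms(1)] digit_act_rescale[OF assms] ..

lemma mem_Delta_digit_iff:
  fixes x :: "real ^ 'n::{finite,linorder}"
  assumes c: "0 < c"
  shows "x \<in> Delta_digit a \<longleftrightarrow> (\<exists>u. (\<forall>j\<in>{1..CARD('n)+1}. 0 \<le> u j) \<and>
      hom_coords x = (\<Sum>j=1..CARD('n)+1. u j *\<^sub>R bisect (CARD('n)) c a vcol j))"
    (is "_ = ?P c")
proof -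
  have "Delta_digit a = hom_simplex (\<lambda>j. column (idx j) (V ** digit_matrix 1 a :: real ^ ('n option) ^ ('n option)))"
    by (simp only: Delta_digit_def proj_simplex_eq A_mat_def)
  also have "\<dots> = hom_simplex (bisect (CARD('n)) 1 a vcol)"
    unfolding hom_simplex_def by (intro arg_cong[where f = "\<lambda>S. convex hull S"] image_cong refl) (simp only: column_V_digit)
  finally have eq: "Delta_digit a = \<dots>" .
  have "0 < (bisect (CARD('n)) 1 a vcol j :: real ^ ('n option)) $ None" if "j \<in> {1..CARD('n)+1}" for j
    using vertices_None_pos[of 1 j "[a]", where 'n='n] that by simp
  then have "x \<in> Delta_digit a \<longleftrightarrow> ?P 1"
    unfolding eq by (rule mem_hom_simplex_iff)
  also have "?P 1 \<longleftrightarrow> ?P c"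
  proof -
    have "?P c''" if "?P c'" "0 < c'" "0 < c''" for c' c''
    proof -
      from that obtain u where u: "\<forall>j\<in>{1..CARD('n)+1}. 0 \<le> u j"
        "hom_coords x = (\<Sum>j=1..CARD('n)+1. u j *\<^sub>R bisect (CARD('n)) c' a vcol j)" by blast
      let ?u = "u(CARD('n)+1 := u (CARD('n)+1) * c' / c'')"
      have "\<forall>j\<in>{1..CARD('n)+1}. 0 \<le> ?u j" using u(1) that by simp
      moreover have "hom_coords x = (\<Sum>j=1..CARD('n)+1. ?u j *\<^sub>R bisect (CARD('n)) c'' a vcol j)"
        unfolding u(2) sum_bisect_rescale[OF card_pos that(3)] ..
      ultimately show ?thesis by blast
    qed
    with c show ?thesis by (meson zero_less_one)
  qed
  finally show ?thesis .
qed

lemma mem_Delta_digitE: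
  fixes x :: "real ^ 'n::{finite,linorder}"
  assumes "0 < c" "x \<in> Delta_digit a"
  obtains u where "\<forall>j\<in>{1..CARD('n)+1}. 0 \<le> u j"
    "hom_coords x = (\<Sum>j=1..CARD('n)+1. u j *\<^sub>R bisect (CARD('n)) c a vcol j)"
  using assms(2) unfolding mem_Delta_digit_iff[OF assms(1)] by (elim exE conjE) (rule that)

lemma mem_Delta_digitI:
  fixes x :: "real ^ 'n::{finite,linorder}"
  assumes "0 < c" "\<forall>j\<in>{1..CARD('n)+1}. 0 \<le> u j"
    "hom_coords x = (\<Sum>j=1..CARD('n)+1. u j *\<^sub>R bisect (CARD('n)) c a vcol j)"
  shows "x \<in> Delta_digit a"
  unfolding mem_Delta_digit_iff[OF assms(1)] by (rule exI[of _ u]) (rule conjI[OF assms(2,3)])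

text \<open>This treats both maps at once, \<open>c = 1\<close> giving \<open>M\<close> and
  \<open>c = 1/2\<close> giving \<open>T\<close>; for the latter the projective division is by 1,
  see \<open>tent_map_eq\<close>.\<close>

definition proj_branch :: "real \<Rightarrow> bool \<Rightarrow> real ^ 'n::{finite,linorder} \<Rightarrow> real ^ 'n::{finite,linorder}" where
  "proj_branch c a x = proj_point (V ** matrix_inv (digit_matrix c a) ** matrix_inv V *v hom_coords x)"

definition proj_map :: "real \<Rightarrow> real ^ 'n::{finite,linorder} \<Rightarrow> real ^ 'n::{finite,linorder}" where
  "proj_map c x = (if x \<in> Delta_digit False then proj_branch c False x else proj_branch c True x)"

lemma moenkemeyer_map_eq: "moenkemeyer_map = proj_map 1"
  by (rule ext) (simp add: moenkemeyer_map_def proj_map_def M_branch_def proj_branch_def M_mat_def A_mat_def)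

lemma tent_map_eq: "(tent_map :: real ^ 'n::{finite,linorder} \<Rightarrow> real ^ 'n::{finite,linorder}) = proj_map (1/2)"
proof -
  have "T_branch a x = proj_branch (1/2) a x" for a and x :: "real ^ 'n::{finite,linorder}"
  proof -
    let ?D = "digit_matrix (1/2) a :: real ^ ('n option) ^ ('n option)"
    let ?V = "V :: real ^ ('n option) ^ ('n option)"
    let ?z = "V ** matrix_inv ?D ** matrix_inv V *v hom_coords x"
    define y where "y = matrix_inv ?V *v ?z"
    define u where "u j = y $ idx j" for j
    have y: "y = vec_of u" by (simp add: vec_of_def u_def vec_eq_iff)
    have V: "?V ** matrix_inv ?V = mat 1" "matrix_inv ?V ** ?V = mat 1"
      by (rule matrix_inv_right[OF invertible_V] matrix_inv_left[OF invertible_V])+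
    have D: "?D ** matrix_inv ?D = mat 1"
      by (rule matrix_inv_right[OF invertible_digit_matrix]) simp
    have "?V *v y = ?z" unfolding y_def by (simp only: matrix_vector_mul_assoc matrix_mul_assoc V matrix_mul_lid)
    then have z: "?z $ None = (\<Sum>j=1..CARD('n)+1. u j)"
      unfolding y mult_vec_of vcol_def[symmetric] by (metis (no_types, lifting) sum.cong sum_component vector_scaleR_component vcol_None mult.right_neutral real_scaleR_def)
    have "y = matrix_inv ?D *v (matrix_inv ?V *v hom_coords x)"
      unfolding y_def by (simp only: matrix_vector_mul_assoc matrix_mul_assoc V matrix_mul_lid)
    then have "(?V ** ?D) *v y = hom_coords x"
      by (simp only: matrix_vector_mul_assoc) (simp only: matrix_mul_assoc[symmetric] D V matrix_mul_rid matrix_mul_lid matrix_vector_mul_lid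
         matrix_mul_assoc[of ?D "matrix_inv ?D"])
    then have "hom_coords x = (\<Sum>j=1..CARD('n)+1. u j *\<^sub>R bisect (CARD('n)) (1/2) a vcol j)"
      unfolding y sum_digit_columns ..
    then have "hom_coords x $ None = (\<Sum>j=1..CARD('n)+1. u j * bisect (CARD('n)) (1/2) a vcol j $ (None :: 'n option))"
      by (simp only: sum_component vector_scaleR_component real_scaleR_def)
    moreover have "bisect (CARD('n)) (1/2) a vcol j $ (None :: 'n option) = 1" for j
      by (simp add: bisect_def vcol_None)
    \<comment> \<open>Both last coordinates are the sum of the \<open>u j\<close>, since the
      vertices of \<Delta> and, for \<open>c = 1/2\<close>, those of the piece all have last
      coordinate 1.\<close>
    ultimately have "?z $ None = 1" unfolding z by (simp del: sum.cl_ivl_Suc)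
    then show ?thesis
      by (simp add: T_branch_def proj_branch_def proj_point_def T_mat_def B_mat_def)
  qed
  then show ?thesis by (intro ext) (simp add: tent_map_def proj_map_def)
qed

text \<open>As a linear map the branch takes the homogeneous vertices of its piece to those of
  \<Delta>, so it preserves coordinates. The factor \<kappa> is the last coordinate that
  \<open>proj_point\<close> divides out.\<close>

lemma proj_branch_eq:
  fixes y :: "real ^ 'n::{finite,linorder}"
  assumes c: "0 < c" and u: "\<forall>j\<in>{1..CARD('n)+1}. 0 \<le> u j"
    and y: "hom_coords y = (\<Sum>j=1..CARD('n)+1. u j *\<^sub>R bisect (CARD('n)) c a vcol j)"
  shows "\<exists>\<kappa>>0. \<kappa> *\<^sub>R hom_coords (proj_branch c a y) = (\<Sum>j=1..CARD('n)+1. u j *\<^sub>R vcol j)"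
proof -
  let ?D = "digit_matrix c a :: real ^ ('n option) ^ ('n option)"
  let ?V = "V :: real ^ ('n option) ^ ('n option)"
  let ?z = "V ** matrix_inv ?D ** matrix_inv V *v hom_coords y"
  have V: "matrix_inv ?V ** ?V = mat 1" by (rule matrix_inv_left[OF invertible_V])
  have D: "matrix_inv ?D ** ?D = mat 1" by (rule matrix_inv_left[OF invertible_digit_matrix[OF c]])
  have "hom_coords y = ?V *v (?D *v vec_of u)"
    unfolding y sum_digit_columns[symmetric] by (simp only: matrix_vector_mul_assoc)
  moreover have "matrix_inv ?V *v (?V *v w) = w" "matrix_inv ?D *v (?D *v w) = w" for w
    by (simp_all only: matrix_vector_mul_assoc V D matrix_vector_mul_lid)
  ultimately have "?z = ?V *v vec_of u" by (simp only: matrix_vector_mul_assoc[symmetric])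
  then have z: "?z = (\<Sum>j=1..CARD('n)+1. u j *\<^sub>R vcol j)"
    unfolding mult_vec_of vcol_def .
  then have zN: "?z $ None = (\<Sum>j=1..CARD('n)+1. u j)"
    by (simp add: vcol_None del: sum.cl_ivl_Suc)
  have "0 < ?z $ None"
  proof -
    have "0 \<le> (\<Sum>j=1..CARD('n)+1. u j)" using u by (intro sum_nonneg) auto
    moreover have "(\<Sum>j=1..CARD('n)+1. u j) \<noteq> 0"
    proof
      assume "(\<Sum>j=1..CARD('n)+1. u j) = 0"
      then have "u j = 0" if "j \<in> {1..CARD('n)+1}" for j
        using sum_nonneg_eq_0_iff[of "{1..CARD('n)+1}" u] u that by blast
      then have "hom_coords y = 0" unfolding y by (intro sum.neutral) simp
      then show False using hom_coords_None[of y] by (simp del: hom_coords_None)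
    qed
    ultimately show ?thesis unfolding zN by linarith
  qed
  moreover from this have "?z $ None *\<^sub>R hom_coords (proj_branch c a y) = ?z"
    unfolding proj_branch_def by (subst hom_proj_point) auto
  ultimately show ?thesis using z by metis
qed

text \<open>On the common face \<open>proj_map\<close> may apply the branch of the other digit; by
  \<open>digit_act_inj\<close> the coordinates are the same there.\<close>

lemma proj_map_step:
  fixes y :: "real ^ 'n::{finite,linorder}"
  assumes c: "0 < c" and u: "\<forall>j\<in>{1..CARD('n)+1}. 0 \<le> u j"
    and y: "hom_coords y = (\<Sum>j=1..CARD('n)+1. u j *\<^sub>R bisect (CARD('n)) c a vcol j)"
  shows "\<exists>\<kappa>>0. \<kappa> *\<^sub>R hom_coords (proj_map c y) = (\<Sum>j=1..CARD('n)+1. u j *\<^sub>R vcol j)"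
proof -
  have ya: "y \<in> Delta_digit a" by (rule mem_Delta_digitI[OF c u y])
  define b where "b = (y \<notin> Delta_digit False)"
  have yb: "y \<in> Delta_digit b" using ya by (cases a; cases "y \<in> Delta_digit False") (auto simp: b_def)
  then obtain u' where u': "\<forall>j\<in>{1..CARD('n)+1}. 0 \<le> u' j"
    "hom_coords y = (\<Sum>j=1..CARD('n)+1. u' j *\<^sub>R bisect (CARD('n)) c b vcol j)"
    by (rule mem_Delta_digitE[OF c])
  have "digit_act (CARD('n)) c a u i = digit_act (CARD('n)) c b u' i" if "i \<in> {1..CARD('n)+1}" for i
    using y u'(2) that unfolding sum_bisect[OF card_pos] by (intro vcol_indep) auto
  then have "u j = u' j" if "j \<in> {1..CARD('n)+1}" for j
    using digit_act_inj[OF card_pos c _ _ _ that, of u u' a b] u u'(1) by blast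
  then have "(\<Sum>j=1..CARD('n)+1. u j *\<^sub>R vcol j) = (\<Sum>j=1..CARD('n)+1. u' j *\<^sub>R (vcol j :: real ^ ('n option)))"
    by (intro sum.cong) auto
  moreover have "proj_map c y = proj_branch c b y" by (simp add: proj_map_def b_def)
  ultimately show ?thesis using proj_branch_eq[OF c u'] by metis
qed

lemma cylinder_Suc: "x \<in> cylinder f a (Suc t) \<longleftrightarrow> x \<in> cylinder f a t \<and> (f ^^ t) x \<in> Delta_digit (a t)"
  by (auto simp: cylinder_def less_Suc_eq)

text \<open>Up to scale, the coordinates of \<open>x\<close> in the cylinder are those of its
  \<open>t\<close>-th iterate in \<Delta>. The induction carries this along because it decides in
  which piece the iterate lies.\<close>

lemma vertices_imp_cylinder:
  fixes x :: "real ^ 'n::{finite,linorder}"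
  assumes c: "0 < c"
    and "\<forall>j\<in>{1..CARD('n)+1}. 0 \<le> u j"
    and "hom_coords x = (\<Sum>j=1..CARD('n)+1. u j *\<^sub>R fold (bisect (CARD('n)) c) (map a [0..<t]) vcol j)"
  shows "x \<in> cylinder (proj_map c) a t \<and>
    (\<exists>\<kappa>>0. \<kappa> *\<^sub>R hom_coords ((proj_map c ^^ t) x) = (\<Sum>j=1..CARD('n)+1. u j *\<^sub>R vcol j))"
  using assms(2,3)
proof (induction t arbitrary: u)
  case 0
  then have "x \<in> Delta" by (intro mem_DeltaI[of u]) (simp_all del: sum.cl_ivl_Suc)
  with 0 show ?case by (simp add: cylinder_def del: sum.cl_ivl_Suc) (rule exI[of _ 1], simp)
next
  case (Suc t)
  let ?u = "digit_act (CARD('n)) c (a t) u"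
  have u0: "\<forall>j\<in>{1..CARD('n)+1}. 0 \<le> ?u j" using Suc.prems(1) c by (intro ballI digit_act_nonneg) auto
  have "hom_coords x = (\<Sum>j=1..CARD('n)+1. u j *\<^sub>R bisect (CARD('n)) c (a t) (fold (bisect (CARD('n)) c) (map a [0..<t]) vcol) j)"
    using Suc.prems(2) by (simp del: sum.cl_ivl_Suc)
  then have "hom_coords x = (\<Sum>j=1..CARD('n)+1. ?u j *\<^sub>R fold (bisect (CARD('n)) c) (map a [0..<t]) vcol j)"
    unfolding sum_bisect[OF card_pos] .
  from Suc.IH[OF u0 this] obtain \<kappa> where x: "x \<in> cylinder (proj_map c) a t" and \<kappa>: "0 < \<kappa>"
    "\<kappa> *\<^sub>R hom_coords ((proj_map c ^^ t) x) = (\<Sum>j=1..CARD('n)+1. ?u j *\<^sub>R vcol j)" by blast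
  let ?y = "(proj_map c ^^ t) x"
  have "hom_coords ?y = inverse \<kappa> *\<^sub>R (\<Sum>j=1..CARD('n)+1. u j *\<^sub>R bisect (CARD('n)) c (a t) vcol j)"
    unfolding sum_bisect[OF card_pos] \<kappa>(2)[symmetric] using \<kappa>(1) by simp
  then have y: "hom_coords ?y = (\<Sum>j=1..CARD('n)+1. (inverse \<kappa> * u j) *\<^sub>R bisect (CARD('n)) c (a t) vcol j)"
    unfolding scaleR_sum_right scaleR_scaleR .
  have v: "\<forall>j\<in>{1..CARD('n)+1}. 0 \<le> inverse \<kappa> * u j" using Suc.prems(1) \<kappa>(1) by simp
  have "?y \<in> Delta_digit (a t)" by (rule mem_Delta_digitI[OF c v y])
  moreover obtain \<kappa>' where \<kappa>': "0 < \<kappa>'" "\<kappa>' *\<^sub>R hom_coords (proj_map c ?y) = (\<Sum>j=1..CARD('n)+1. (inverse \<kappa> * u j) *\<^sub>R vcol j)"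
    using proj_map_step[OF c v y] by blast
  have "(\<kappa> * \<kappa>') *\<^sub>R hom_coords (proj_map c ?y) = (\<Sum>j=1..CARD('n)+1. u j *\<^sub>R vcol j)"
  proof -
    have "(\<kappa> * \<kappa>') *\<^sub>R hom_coords (proj_map c ?y) = \<kappa> *\<^sub>R (\<Sum>j=1..CARD('n)+1. (inverse \<kappa> * u j) *\<^sub>R vcol j)"
      unfolding \<kappa>'(2)[symmetric] by simp
    also have "\<dots> = (\<Sum>j=1..CARD('n)+1. u j *\<^sub>R vcol j)"
      unfolding scaleR_sum_right scaleR_scaleR using \<kappa>(1) by (simp add: mult.assoc[symmetric] del: sum.cl_ivl_Suc)
    finally show ?thesis .
  qed
  moreover have "0 < \<kappa> * \<kappa>'" using \<kappa>(1) \<kappa>'(1) by simp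
  ultimately show ?case using x by (auto simp: cylinder_Suc)
qed

text \<open>The coordinates of the iterate in its piece, scaled by \<kappa>, serve for
  \<open>x\<close> in the smaller cylinder, because coordinates with respect to \<open>vcol\<close>
  are unique.\<close>

lemma cylinder_imp_vertices:
  fixes x :: "real ^ 'n::{finite,linorder}"
  assumes c: "0 < c" and "x \<in> cylinder (proj_map c) a t"
  shows "\<exists>u. (\<forall>j\<in>{1..CARD('n)+1}. 0 \<le> u j) \<and>
    hom_coords x = (\<Sum>j=1..CARD('n)+1. u j *\<^sub>R fold (bisect (CARD('n)) c) (map a [0..<t]) vcol j)"
  using assms(2)
proof (induction t)
  case 0
  then show ?case by (simp add: cylinder_def mem_Delta_iff del: sum.cl_ivl_Suc)
next
  case (Suc t)
  let ?W = "fold (bisect (CARD('n)) c) (map a [0..<t]) vcol :: nat \<Rightarrow> real ^ ('n option)"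
  let ?y = "(proj_map c ^^ t) x"
  obtain u where u: "\<forall>j\<in>{1..CARD('n)+1}. 0 \<le> u j" "hom_coords x = (\<Sum>j=1..CARD('n)+1. u j *\<^sub>R ?W j)"
    using Suc by (auto simp: cylinder_Suc)
  obtain \<kappa> where \<kappa>: "0 < \<kappa>" "\<kappa> *\<^sub>R hom_coords ?y = (\<Sum>j=1..CARD('n)+1. u j *\<^sub>R vcol j)"
    using vertices_imp_cylinder[OF c u] by blast
  have "?y \<in> Delta_digit (a t)" using Suc.prems by (simp add: cylinder_Suc)
  then obtain v where v: "\<forall>j\<in>{1..CARD('n)+1}. 0 \<le> v j"
    "hom_coords ?y = (\<Sum>j=1..CARD('n)+1. v j *\<^sub>R bisect (CARD('n)) c (a t) vcol j)"
    by (rule mem_Delta_digitE[OF c])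
  let ?v = "\<lambda>j. \<kappa> * v j"
  have "(\<Sum>j=1..CARD('n)+1. u j *\<^sub>R vcol j) = (\<Sum>j=1..CARD('n)+1. digit_act (CARD('n)) c (a t) ?v j *\<^sub>R (vcol j :: real ^ ('n option)))"
    unfolding \<kappa>(2)[symmetric] v(2) sum_bisect[OF card_pos] digit_act_scale scaleR_sum_right scaleR_scaleR ..
  then have "u j = digit_act (CARD('n)) c (a t) ?v j" if "j \<in> {1..CARD('n)+1}" for j
    using that by (rule vcol_indep)
  then have "hom_coords x = (\<Sum>j=1..CARD('n)+1. digit_act (CARD('n)) c (a t) ?v j *\<^sub>R ?W j)"
    unfolding u(2) by (intro sum.cong) auto
  also have "\<dots> = (\<Sum>j=1..CARD('n)+1. ?v j *\<^sub>R fold (bisect (CARD('n)) c) (map a [0..<Suc t]) vcol j)"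
    unfolding sum_bisect[OF card_pos, symmetric] by (simp del: sum.cl_ivl_Suc)
  finally have "hom_coords x = (\<Sum>j=1..CARD('n)+1. ?v j *\<^sub>R fold (bisect (CARD('n)) c) (map a [0..<Suc t]) vcol j)" .
  moreover have "\<forall>j\<in>{1..CARD('n)+1}. 0 \<le> ?v j" using v(1) \<kappa>(1) by simp
  ultimately show ?case by (intro exI[of _ ?v] conjI)
qed

lemma cylinder_eq_hom_simplex:
  assumes c: "0 < c"
  shows "cylinder (proj_map c) a t = (hom_simplex (fold (bisect (CARD('n)) c) (map a [0..<t]) vcol) :: (real ^ 'n::{finite,linorder}) set)"
proof (intro set_eqI iffI)
  fix x :: "real ^ 'n::{finite,linorder}"
  have mem: "x \<in> hom_simplex (fold (bisect (CARD('n)) c) (map a [0..<t]) vcol) \<longleftrightarrow>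
    (\<exists>u. (\<forall>j\<in>{1..CARD('n)+1}. 0 \<le> u j) \<and>
      hom_coords x = (\<Sum>j=1..CARD('n)+1. u j *\<^sub>R fold (bisect (CARD('n)) c) (map a [0..<t]) vcol j))"
    by (rule mem_hom_simplex_iff) (rule vertices_None_pos[OF c])
  show "x \<in> hom_simplex (fold (bisect (CARD('n)) c) (map a [0..<t]) vcol)" if "x \<in> cylinder (proj_map c) a t"
    unfolding mem by (rule cylinder_imp_vertices[OF c that])
  show "x \<in> cylinder (proj_map c) a t" if "x \<in> hom_simplex (fold (bisect (CARD('n)) c) (map a [0..<t]) vcol)"
    using that unfolding mem
    by (elim exE conjE) (rule vertices_imp_cylinder[OF c, THEN conjunct1])
qed

lemma compact_hom_simplex: "compact (hom_simplex W)"
  unfolding hom_simplex_def by (intro finite_imp_compact_convex_hull) simp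

text \<open>The cylinders are nested nonempty compact simplices, and the diameter of a simplex is
  attained at two vertices, which \<open>fold_bisect_shrink\<close> brings together. The hypothesis
  \<open>K\<close> is the point where the two maps need different arguments.\<close>

lemma cylinder_singleton:
  assumes c: "0 < c" "c \<le> 1"
    and K: "\<And>t i j. i \<in> {1..CARD('n)+1} \<Longrightarrow> j \<in> {1..CARD('n)+1} \<Longrightarrow>
      fold (bisect (CARD('n)) c) (map a [0..<t]) (\<lambda>_. 1) i
      \<le> (real t + 1) * fold (bisect (CARD('n)) c) (map a [0..<t]) (\<lambda>_. 1) j"
  shows "\<exists>p::real ^ 'n::{finite,linorder}. (\<Inter>t. cylinder (proj_map c) a t) = {p}"
proof (rule decreasing_closed_nest_sing)
  show "closed (cylinder (proj_map c) a t :: (real ^ 'n::{finite,linorder}) set)" for t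
    unfolding cylinder_eq_hom_simplex[OF c(1)] by (intro compact_imp_closed compact_hom_simplex)
  show "(cylinder (proj_map c) a t :: (real ^ 'n::{finite,linorder}) set) \<noteq> {}" for t
    unfolding cylinder_eq_hom_simplex[OF c(1)] hom_simplex_def by simp
  show "(cylinder (proj_map c) a t :: (real ^ 'n::{finite,linorder}) set) \<subseteq> cylinder (proj_map c) a s" if "s \<le> t" for s t
    using that by (auto simp: cylinder_def)
  fix e :: real assume e: "0 < e"
  \<comment> \<open>These are the numerators of the vertices; the matching denominators start from
    the constant 1.\<close>
  let ?X = "\<lambda>j. (\<chi> i. vcol j $ Some i) :: real ^ 'n::{finite,linorder}"
  obtain t where t: "\<forall>i\<in>{1..CARD('n)+1}. \<forall>j\<in>{1..CARD('n)+1}.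
     norm (fold (bisect (CARD('n)) c) (map a [0..<t]) ?X i /\<^sub>R fold (bisect (CARD('n)) c) (map a [0..<t]) (\<lambda>_. 1) i
      - fold (bisect (CARD('n)) c) (map a [0..<t]) ?X j /\<^sub>R fold (bisect (CARD('n)) c) (map a [0..<t]) (\<lambda>_. 1) j) < e"
    using fold_bisect_shrink[OF card_pos c _ K e, of ?X] by auto
  let ?W = "fold (bisect (CARD('n)) c) (map a [0..<t]) vcol :: nat \<Rightarrow> real ^ ('n option)"
  let ?S = "(\<lambda>j. proj_point (?W j)) ` {1..CARD('n)+1}"
  have lin: "linear (\<lambda>w :: real ^ ('n option). \<chi> i. w $ Some i)"
    by (intro linearI) (simp_all add: vec_eq_iff)
  have pp: "proj_point (?W j) = fold (bisect (CARD('n)) c) (map a [0..<t]) ?X j /\<^sub>R fold (bisect (CARD('n)) c) (map a [0..<t]) (\<lambda>_. 1) j" for j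
    unfolding linear_fold_bisect[OF lin, symmetric]
    by (simp add: proj_point_def vec_eq_iff divide_inverse mult.commute column_vertices_None)
  obtain x y where xy: "x \<in> ?S" "y \<in> ?S" "\<forall>z\<in>convex hull ?S. \<forall>w\<in>convex hull ?S. norm (z - w) \<le> norm (x - y)"
    using simplex_extremal_le[of ?S] by auto
  have "norm (x - y) < e" using xy(1,2) t by (auto simp: pp simp del: fold_map)
  then have "\<forall>z\<in>convex hull ?S. \<forall>w\<in>convex hull ?S. dist z w < e"
    using xy(3) by (auto simp: dist_norm intro: le_less_trans)
  then show "\<exists>t. \<forall>x\<in>cylinder (proj_map c) a t. \<forall>y\<in>cylinder (proj_map c) a t. dist (x :: real ^ 'n::{finite,linorder}) y < e"
    unfolding cylinder_eq_hom_simplex[OF c(1)] hom_simplex_def by blast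
qed

lemma phi_cylinders: "(\<Inter>t. cylinder moenkemeyer_map a t) = {phi a :: real ^ 'n::{finite,linorder}}"
proof -
  have "\<exists>p::real ^ 'n::{finite,linorder}. (\<Inter>t. cylinder moenkemeyer_map a t) = {p}"
    unfolding moenkemeyer_map_eq
    by (rule cylinder_singleton) (use queue_sorted_ratio[OF card_pos[where 'n='n], of _ _ "map a [0..<t]" for t] in auto)
  then show ?thesis unfolding phi_def by (metis singletonD singletonI the_equality)
qed

lemma upsilon_cylinders: "(\<Inter>t. cylinder tent_map a t) = {upsilon a :: real ^ 'n::{finite,linorder}}"
proof -
  have "\<exists>p::real ^ 'n::{finite,linorder}. (\<Inter>t. cylinder tent_map a t) = {p}"
    unfolding tent_map_eq by (rule cylinder_singleton) (auto simp: fold_bisect_half_const simp del: fold_map)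
  then show ?thesis unfolding upsilon_def by (metis singletonD singletonI the_equality)
qed

text \<open>\<Delta> is covered by its two pieces and invariant under \<open>M\<close>, so the
  itinerary of \<open>p\<close> is a code.\<close>

lemma exists_phi_code:
  fixes p :: "real ^ 'n::{finite,linorder}"
  assumes "p \<in> Delta"
  shows "\<exists>a. phi a = p"
proof -
  let ?f = "proj_map 1 :: real ^ 'n::{finite,linorder} \<Rightarrow> real ^ 'n::{finite,linorder}"
  have split: "\<exists>a u. (\<forall>j\<in>{1..CARD('n)+1}. 0 \<le> u j) \<and>
      hom_coords y = (\<Sum>j=1..CARD('n)+1. u j *\<^sub>R bisect (CARD('n)) 1 a vcol j)"
    if "y \<in> Delta" for y :: "real ^ 'n::{finite,linorder}"
  proof -
    obtain u where u: "\<forall>j\<in>{1..CARD('n)+1}. 0 \<le> u j" "hom_coords y = (\<Sum>j=1..CARD('n)+1. u j *\<^sub>R vcol j)"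
      using \<open>y \<in> Delta\<close> by (rule mem_DeltaE)
    \<comment> \<open>This inverts \<open>digit_act\<close> for the digit \<open>u 1 < u 2\<close>:
      the smaller of the first two coordinates goes to the new vertex, and the surplus stays with
      the vertex that is kept.\<close>
    define v where "v j = (if j = 1 then \<bar>u 1 - u 2\<bar> else if j = CARD('n) + 1 then min (u 1) (u 2) else u (Suc j))" for j
    have n: "1 \<le> CARD('n)" by (rule card_pos)
    have "digit_act (CARD('n)) 1 (u 1 < u 2) v i = u i" if i: "i \<in> {1..CARD('n)+1}" for i
    proof -
      have "i = 1 \<or> i = 2 \<or> 3 \<le> i" using i by auto
      then show ?thesis using i n by (elim disjE) (auto simp: digit_act_def v_def)
    qed
    then have "hom_coords y = (\<Sum>j=1..CARD('n)+1. v j *\<^sub>R bisect (CARD('n)) 1 (u 1 < u 2) vcol j)"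
      unfolding sum_bisect[OF n] u(2) by (intro sum.cong) auto
    moreover have "\<forall>j\<in>{1..CARD('n)+1}. 0 \<le> v j"
      using u(1) n by (auto simp: v_def)
    ultimately show ?thesis by (intro exI[of _ "u 1 < u 2"] exI[of _ v] conjI)
  qed
  have inv: "?f y \<in> Delta" if "y \<in> Delta" for y
  proof -
    obtain a u where u: "\<forall>j\<in>{1..CARD('n)+1}. 0 \<le> u j"
      "hom_coords y = (\<Sum>j=1..CARD('n)+1. u j *\<^sub>R bisect (CARD('n)) 1 a vcol j)"
      using split[OF \<open>y \<in> Delta\<close>] by (elim exE conjE) (rule that)
    obtain \<kappa> where \<kappa>: "0 < \<kappa>" "\<kappa> *\<^sub>R hom_coords (?f y) = (\<Sum>j=1..CARD('n)+1. u j *\<^sub>R vcol j)"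
      using proj_map_step[OF zero_less_one u] by (elim exE conjE) (rule that)
    have "hom_coords (?f y) = inverse \<kappa> *\<^sub>R (\<Sum>j=1..CARD('n)+1. u j *\<^sub>R vcol j)"
      unfolding \<kappa>(2)[symmetric] using \<kappa>(1) by simp
    then have "hom_coords (?f y) = (\<Sum>j=1..CARD('n)+1. (inverse \<kappa> * u j) *\<^sub>R vcol j)"
      unfolding scaleR_sum_right scaleR_scaleR .
    moreover have "\<forall>j\<in>{1..CARD('n)+1}. 0 \<le> inverse \<kappa> * u j" using u(1) \<kappa>(1) by simp
    ultimately show ?thesis by (intro mem_DeltaI)
  qed
  define a where "a i = ((?f ^^ i) p \<notin> Delta_digit False)" for i
  have orbit: "(?f ^^ i) p \<in> Delta" for i
    by (induction i) (use assms inv in auto)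
  have "(?f ^^ i) p \<in> Delta_digit (a i)" for i
  proof -
    obtain b where "(?f ^^ i) p \<in> Delta_digit b"
      using split[OF orbit[of i]] by (elim exE conjE) (rule that, rule mem_Delta_digitI[OF zero_less_one])
    then show ?thesis by (cases b; cases "(?f ^^ i) p \<in> Delta_digit False") (auto simp: a_def)
  qed
  then have "p \<in> (\<Inter>t. cylinder moenkemeyer_map a t)"
    using assms by (auto simp: cylinder_def moenkemeyer_map_eq)
  then show ?thesis unfolding phi_cylinders by auto
qed

section \<open>Volumes\<close>

text \<open>The library computes the factor as a determinant, but only for well-ordered index types.\<close>

lemma linear_image_measure_factor:
  fixes f :: "real ^ 'm::finite \<Rightarrow> real ^ 'm::finite"
  assumes "linear f"
  shows "\<exists>r. \<forall>S\<in>lmeasurable. f ` S \<in> lmeasurable \<and> measure lebesgue (f ` S) = r * measure lebesgue S"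
proof (rule induct_linear_elementary[OF assms])
  let ?P = "\<lambda>f :: real ^ 'm \<Rightarrow> real ^ 'm.
    \<exists>r. \<forall>S\<in>lmeasurable. f ` S \<in> lmeasurable \<and> measure lebesgue (f ` S) = r * measure lebesgue S"
  show "?P (f \<circ> g)" if f: "?P f" and g: "?P g" for f g
  proof -
    obtain r where "\<forall>S\<in>lmeasurable. f ` S \<in> lmeasurable \<and> measure lebesgue (f ` S) = r * measure lebesgue S"
      using f by (elim exE)
    moreover obtain r' where "\<forall>S\<in>lmeasurable. g ` S \<in> lmeasurable \<and> measure lebesgue (g ` S) = r' * measure lebesgue S"
      using g by (elim exE)
    ultimately have "(f \<circ> g) ` S \<in> lmeasurable \<and> measure lebesgue ((f \<circ> g) ` S) = r * r' * measure lebesgue S"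
      if "S \<in> lmeasurable" for S
      unfolding image_comp[symmetric] using that by (metis mult.assoc)
    then show ?thesis by blast
  qed
  show "?P f" if "linear f" "\<And>x. f x $ i = 0" for f i
  proof -
    have "\<not> inj f"
      using linear_injective_imp_surjective[OF that(1)] that(2) by (metis one_neq_zero surjD vec_component)
    then have "negligible (f ` S)" for S by (rule negligible_linear_singular_image[OF that(1)])
    then show ?thesis
      by (intro exI[of _ 0]) (auto simp: negligible_imp_measure0 negligible_imp_measurable)
  qed
  show "?P (\<lambda>x. \<chi> i. c i * x $ i)" for c
    using measurable_stretch measure_stretch by blast
  show "?P (\<lambda>x. \<chi> i. x $ Transposition.transpose m n i)" for m n :: 'm
  proof -
    let ?t = "Transposition.transpose m n"
    let ?h = "\<lambda>x :: real ^ 'm. \<chi> i. x $ ?t i"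
    have lin: "linear ?h" by (intro linearI) (simp_all add: vec_eq_iff)
    have box: "?h ` cbox a b = cbox (?h a) (?h b)" for a b
    proof (intro set_eqI iffI)
      fix x assume "x \<in> cbox (?h a) (?h b)"
      then have "a $ ?t (?t i) \<le> x $ ?t i \<and> x $ ?t i \<le> b $ ?t (?t i)" for i
        unfolding mem_box_cart by (metis vec_lambda_beta)
      then have "?h x \<in> cbox a b" by (simp add: mem_box_cart)
      moreover have "x = ?h (?h x)" by (simp add: vec_eq_iff)
      ultimately show "x \<in> ?h ` cbox a b" by blast
    qed (auto simp: mem_box_cart)
    have "measure lebesgue (?h ` cbox a b) = 1 * measure lebesgue (cbox a b)" for a b
    proof (cases "cbox a b = {}")
      case False
      then have "cbox (?h a) (?h b) \<noteq> {}" unfolding box[symmetric] by simp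
      with False show ?thesis
        unfolding box using prod.permute[OF permutes_swap_id, of m UNIV n "\<lambda>i. b $ i - a $ i"]
        by (simp add: content_cbox_cart o_def)
    qed simp
    note meq = this
    have "?h ` S \<in> lmeasurable \<and> measure lebesgue (?h ` S) = 1 * measure lebesgue S" if "S \<in> lmeasurable" for S
      using measure_linear_sufficient[OF lin that meq] by (elim conjE) (rule conjI, assumption, erule sym)
    then show ?thesis by (intro exI[of _ 1] ballI)
  qed
  show "?P (\<lambda>x. \<chi> i. if i = m then x $ m + x $ n else x $ i)" if "m \<noteq> n" for m n :: 'm
  proof -
    let ?h = "\<lambda>x :: real ^ 'm. \<chi> i. if i = m then x $ m + x $ n else x $ i"
    have lin: "linear ?h" by (intro linearI) (simp_all add: vec_eq_iff algebra_simps)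
    have "measure lebesgue (?h ` cbox a b) = 1 * measure lebesgue (cbox a b)" for a b
    proof (cases "cbox a b = {}")
      case False
      \<comment> \<open>The translation puts the n-th coordinate of the lower corner at 0, so that
        the formula for sheared boxes applies.\<close>
      let ?c = "axis n (a $ n) :: real ^ 'm"
      have ab: "cbox a b = (+) ?c ` cbox (a - ?c) (b - ?c)"
        by (simp add: cbox_translation[symmetric])
      have "?h ` cbox a b = (+) (?h ?c) ` ?h ` cbox (a - ?c) (b - ?c)"
        unfolding ab image_image by (simp only: linear_add[OF lin])
      then have "measure lebesgue (?h ` cbox a b) = measure lebesgue (?h ` cbox (a - ?c) (b - ?c))"
        by (simp only: measure_translation)
      also have "\<dots> = measure lebesgue (cbox (a - ?c) (b - ?c))"
        using that False ab by (intro measure_shear_interval) auto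
      also have "\<dots> = measure lebesgue (cbox a b)"
        unfolding ab by (simp only: measure_translation)
      finally show ?thesis by simp
    qed simp
    note meq = this
    have "?h ` S \<in> lmeasurable \<and> measure lebesgue (?h ` S) = 1 * measure lebesgue S" if "S \<in> lmeasurable" for S
      using measure_linear_sufficient[OF lin that meq] by (elim conjE) (rule conjI, assumption, erule sym)
    then show ?thesis by (intro exI[of _ 1] ballI)
  qed
qed

text \<open>With \<open>X k\<close> moved to the origin, the replacement scales one edge by
  \<open>s\<close>. Both simplices are then images under one linear map, of the standard simplex and
  of a stretched copy, and the unknown factor of that map is common to both.\<close>

lemma measure_convex_hull_split:
  fixes X :: "nat \<Rightarrow> real ^ 'm::finite"
  assumes R: "finite R" "card R = CARD('m::finite) + 1" and k: "k \<in> R" "d \<in> R" "k \<noteq> d" and s: "0 \<le> s"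
  shows "measure lebesgue (convex hull (insert ((1 - s) *\<^sub>R X k + s *\<^sub>R X d) (X ` (R - {d}))))
    = s * measure lebesgue (convex hull (X ` R))"
proof -
  \<comment> \<open>The vertices other than \<open>X k\<close> are labelled by the coordinate
    directions; \<open>m\<close> is the direction of the edge to \<open>X d\<close>.\<close>
  have "card (UNIV :: 'm set) = card (R - {k})" using R k by simp
  then obtain \<sigma> where \<sigma>: "bij_betw \<sigma> (UNIV :: 'm set) (R - {k})"
    using finite_same_card_bij R by (metis finite finite_Diff)
  then obtain m where m: "\<sigma> m = d" using k by (metis DiffI bij_betw_imp_surj_on imageE singletonD)
  let ?v = "\<lambda>j. X (\<sigma> j)"
  let ?z = "(1 - s) *\<^sub>R X k + s *\<^sub>R X d"
  have rng: "\<sigma> ` UNIV = R - {k}" using \<sigma> by (rule bij_betw_imp_surj_on)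
  have 1: "X ` R = insert (X k) (range ?v)"
  proof -
    have "range ?v = X ` (R - {k})" unfolding rng[symmetric] by (simp add: image_image)
    then show ?thesis using k(1) by auto
  qed
  have 2: "insert ?z (X ` (R - {d})) = insert (X k) (range (?v(m := ?z)))"
  proof -
    have "\<sigma> ` (UNIV - {m}) = R - {k} - {d}"
      using rng m \<sigma> by (auto simp: bij_betw_def inj_on_def image_iff)
    then have "?v ` (UNIV - {m}) = X ` (R - {k} - {d})" by (metis image_image)
    moreover have "range (?v(m := ?z)) = insert ?z (?v ` (UNIV - {m}))" by auto
    moreover have "R - {d} = insert k (R - {k} - {d})" using k by auto
    ultimately show ?thesis by auto
  qed
  let ?M = "\<chi> i j. (?v j - X k) $ i"
  let ?S = "insert 0 (range (\<lambda>j::'m. axis j (1::real)))"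
  let ?d = "\<lambda>y :: real ^ 'm. \<chi> i. (if i = m then s else 1) * y $ i"
  have col: "?M *v axis j 1 = ?v j - X k" for j
    by (simp add: matrix_vector_mult_basis column_def vec_eq_iff)
  have lin: "linear (\<lambda>y. ?M *v y)" by simp
  have lind: "linear ?d" by (intro linearI) (simp_all add: vec_eq_iff algebra_simps)
  have d: "?d (axis j 1) = (if j = m then s else 1) *\<^sub>R axis j 1" for j
    by (simp add: vec_eq_iff axis_def)
  have S: "convex hull ?S \<in> lmeasurable"
    by (intro lmeasurable_compact finite_imp_compact_convex_hull) simp
  have old: "insert (X k) (range ?v) = (+) (X k) ` (\<lambda>y. ?M *v y) ` ?S"
    by (simp only: image_insert image_image matrix_vector_mult_0_right add_0_right col) simp
  have new: "insert (X k) (range (?v(m := ?z))) = (+) (X k) ` (\<lambda>y. ?M *v y) ` ?d ` ?S"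
  proof -
    have "X k + ?M *v ?d (axis j 1) = (?v(m := ?z)) j" for j
      unfolding d matrix_vector_mult_scaleR col using m by (simp add: algebra_simps)
    moreover have "X k + ?M *v ?d 0 = X k" using linear_0[OF lind] by simp
    ultimately show ?thesis by (simp only: image_insert image_image)
  qed
  obtain r where r: "\<And>S. S \<in> lmeasurable \<Longrightarrow> measure lebesgue ((\<lambda>y. ?M *v y) ` S) = r * measure lebesgue S"
    using linear_image_measure_factor[OF lin] by blast
  have "measure lebesgue (?d ` (convex hull ?S)) = s * measure lebesgue (convex hull ?S)"
    using measure_stretch[OF S, of "\<lambda>i. if i = m then s else 1"] s by (simp add: prod.delta)
  moreover have "?d ` (convex hull ?S) \<in> lmeasurable" by (rule measurable_stretch[OF S])
  ultimately show ?thesis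
    unfolding 1 2 old new convex_hull_translation convex_hull_linear_image[OF lin, symmetric]
      convex_hull_linear_image[OF lind, symmetric] measure_translation
    by (simp only: r S mult.left_commute)
qed

lemma measure_hom_simplex:
  assumes c: "0 < c"
  shows "measure lebesgue (hom_simplex (fold (bisect (CARD('n)) c) bs vcol) :: (real ^ 'n::{finite,linorder}) set)
    = volume_ratio (CARD('n)) c (\<lambda>_. 1) bs * measure lebesgue (Delta :: (real ^ 'n::{finite,linorder}) set)"
proof (induction bs rule: rev_induct)
  case Nil
  show ?case by (simp add: Delta_eq_hom_simplex)
next
  case (snoc b bs)
  let ?n = "CARD('n)"
  let ?R = "{1..?n+1}"
  define W where "W = (fold (bisect ?n c) bs vcol :: nat \<Rightarrow> real ^ ('n option))"
  define q where "q = fold (bisect ?n c) bs (\<lambda>_. 1::real)"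
  let ?X = "\<lambda>j. proj_point (W j)"
  define k :: nat where "k = (if b then 2 else 1)"
  define d :: nat where "d = (if b then 1 else 2)"
  define s where "s = ratio q b"
  have n: "1 \<le> ?n" by (rule card_pos)
  have WN: "W j $ None = q j" for j by (simp add: W_def q_def column_vertices_None)
  have q: "0 < q 1" "0 < q 2"
    using vertices_None_pos[OF c, of _ bs, where 'n='n] n unfolding W_def[symmetric] WN by auto
  have e: "1 - q 1 / (q 1 + q 2) = q 2 / (q 1 + q 2)" "1 - q 2 / (q 1 + q 2) = q 1 / (q 1 + q 2)"
    using q by (simp_all add: field_simps)
  \<comment> \<open>The factor \<open>c\<close> cancels in \<open>proj_point\<close>, and the weight
    of the dropped vertex is its share of \<open>q 1 + q 2\<close>, that is
    \<open>ratio q b\<close>.\<close>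
  have z: "proj_point (c *\<^sub>R (W 1 + W 2)) = (1 - s) *\<^sub>R ?X k + s *\<^sub>R ?X d"
    using q c by (cases b) (simp_all add: proj_point_def vec_eq_iff WN s_def k_def d_def ratio_def e add_divide_distrib del: One_nat_def)
  have W': "fold (bisect ?n c) (bs @ [b]) vcol j = bisect ?n c b W j" for j
    by (simp add: W_def)
  have img: "(\<lambda>j. proj_point (bisect ?n c b W j)) ` ?R = insert ((1 - s) *\<^sub>R ?X k + s *\<^sub>R ?X d) (?X ` (?R - {d}))"
  proof -
    have R: "?R = insert 1 (insert (?n+1) {2..?n})" using n by auto
    have "(\<lambda>j. proj_point (bisect ?n c b W j)) ` {2..?n} = ?X ` Suc ` {2..?n}"
      unfolding image_image by (intro image_cong refl) (auto simp: bisect_def)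
    also have "Suc ` {2..?n} = {3..?n+1}" by (simp add: numeral_3_eq_3 numeral_2_eq_2)
    finally have mid: "(\<lambda>j. proj_point (bisect ?n c b W j)) ` {2..?n} = ?X ` {3..?n+1}" .
    have first: "bisect ?n c b W 1 = W k" by (simp add: bisect_def k_def)
    have last: "bisect ?n c b W (?n+1) = c *\<^sub>R (W 1 + W 2)" using n by (simp add: bisect_def)
    have Rd: "?R - {d} = insert k {3..?n+1}" using n by (auto simp: k_def d_def)
    show ?thesis
      unfolding Rd by (subst R) (simp only: image_insert mid first last z insert_commute)
  qed
  have "measure lebesgue (hom_simplex (fold (bisect ?n c) (bs @ [b]) vcol) :: (real ^ 'n::{finite,linorder}) set)
    = s * measure lebesgue (convex hull (?X ` ?R))"
    unfolding hom_simplex_def W' img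
    by (rule measure_convex_hull_split) (use n q in \<open>auto simp: k_def d_def s_def ratio_def\<close>)
  also have "convex hull (?X ` ?R) = hom_simplex W" by (simp only: hom_simplex_def)
  also have "measure lebesgue (hom_simplex W) = volume_ratio ?n c (\<lambda>_. 1) bs * measure lebesgue (Delta :: (real ^ 'n::{finite,linorder}) set)"
    unfolding W_def by (rule snoc.IH)
  finally show ?case by (simp only: volume_ratio_snoc s_def q_def) (simp add: mult_ac)
qed

lemma lmeasurable_hom_simplex: "hom_simplex W \<in> lmeasurable"
  by (intro lmeasurable_compact compact_hom_simplex)

text \<open>Strict positivity of all coordinates with respect to \<open>V\<close> cuts out an open
  subset of \<Delta>, which contains the point whose coordinates are all equal.\<close>

lemma measure_Delta_pos: "0 < measure lebesgue (Delta :: (real ^ 'n::{finite,linorder}) set)"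
proof -
  let ?V = "V :: real ^ ('n option) ^ ('n option)"
  define f where "f k x = (matrix_inv ?V *v hom_coords x) $ k" for k and x :: "real ^ 'n::{finite,linorder}"
  define U where "U = (\<Inter>k. {x. 0 < f k x})"
  have cont: "continuous_on UNIV (f k)" for k
  proof -
    have "continuous_on UNIV (\<lambda>x :: real ^ 'n::{finite,linorder}. hom_coords x $ l)" for l
      by (cases l) (auto intro!: continuous_intros)
    then show ?thesis unfolding f_def matrix_vector_mult_def vec_lambda_beta
      by (intro continuous_on_sum continuous_on_mult continuous_on_const)
  qed
  have "open U" unfolding U_def
    by (intro open_INT finite) (auto intro!: open_Collect_less continuous_intros cont)
  moreover have "U \<subseteq> Delta"
  proof
    fix x assume "x \<in> U"
    then have p: "0 \<le> f k x" for k by (simp add: U_def less_imp_le)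
    let ?y = "matrix_inv ?V *v hom_coords x"
    have "?V *v ?y = hom_coords x"
      by (simp only: matrix_vector_mul_assoc matrix_inv_right[OF invertible_V] matrix_vector_mul_lid)
    moreover have "?y = vec_of (\<lambda>j. f (idx j) x)" by (simp add: vec_of_def f_def vec_eq_iff)
    ultimately have "hom_coords x = ?V *v vec_of (\<lambda>j. f (idx j) x)" by simp
    then have "hom_coords x = (\<Sum>j=1..CARD('n)+1. f (idx j) x *\<^sub>R vcol j)"
      unfolding mult_vec_of vcol_def .
    moreover have "\<forall>j\<in>{1..CARD('n)+1}. 0 \<le> f (idx j) x" using p by blast
    ultimately show "x \<in> Delta" by (intro mem_DeltaI)
  qed
  moreover have "U \<noteq> {}"
  proof -
    let ?one = "(\<chi> k. 1) :: real ^ ('n option)"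
    let ?r = "(?V *v ?one) $ None"
    have r: "0 < ?r" by (simp add: matrix_vector_mult_def V_def pos_None)
    have "matrix_inv ?V *v (?V *v ?one) = ?one"
      by (simp only: matrix_vector_mul_assoc matrix_inv_left[OF invertible_V] matrix_vector_mul_lid)
    moreover have "hom_coords (proj_point (?V *v ?one)) = (?V *v ?one) /\<^sub>R ?r"
      using r by (intro hom_proj_point) simp
    ultimately have "f k (proj_point (?V *v ?one)) = inverse ?r" for k
      unfolding f_def by (simp add: matrix_vector_mult_scaleR)
    then have "proj_point (?V *v ?one) \<in> U" unfolding U_def using r by simp
    then show ?thesis by blast
  qed
  ultimately have "interior (Delta :: (real ^ 'n::{finite,linorder}) set) \<noteq> {}"
    by (metis interior_maximal subset_empty)
  moreover have "convex (Delta :: (real ^ 'n::{finite,linorder}) set)"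
    unfolding Delta_def proj_simplex_def by (rule convex_convex_hull)
  ultimately have "\<not> negligible (Delta :: (real ^ 'n::{finite,linorder}) set)"
    using negligible_convex_interior by blast
  moreover have "(Delta :: (real ^ 'n::{finite,linorder}) set) \<in> lmeasurable"
    unfolding Delta_eq_hom_simplex by (rule lmeasurable_hom_simplex)
  ultimately show ?thesis
    by (metis measure_nonneg less_eq_real_def negligible_iff_measure)
qed

section \<open>Singularity\<close>

text \<open>The smaller of two volumes is at most their geometric mean, and the geometric means add
  up to the affinity. This serves \<open>c = 1\<close> on words where the cylinder of
  \<open>M\<close> is smaller and \<open>c = 1/2\<close> on the other words.\<close>

lemma measure_UN_hom_simplex_le:
  assumes c: "0 < c" and B: "B \<subseteq> {bs. length bs = t}"
    and le: "\<And>bs. bs \<in> B \<Longrightarrow> volume_ratio (CARD('n)) c (\<lambda>_. 1) bs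
       \<le> sqrt ((1/2) ^ t * volume_ratio (CARD('n)) 1 (\<lambda>_. 1) bs)"
  shows "measure lebesgue (\<Union>bs\<in>B. hom_simplex (fold (bisect (CARD('n)) c) bs vcol) :: (real ^ 'n::{finite,linorder}) set)
    \<le> affinity (CARD('n)) t (\<lambda>_. 1) * measure lebesgue (Delta :: (real ^ 'n::{finite,linorder}) set)"
proof -
  let ?D = "measure lebesgue (Delta :: (real ^ 'n::{finite,linorder}) set)"
  let ?r = "\<lambda>bs. sqrt ((1/2) ^ t * volume_ratio (CARD('n)) 1 (\<lambda>_. 1) bs)"
  have s: "queue_sorted (CARD('n)) (\<lambda>_. 1)" by (simp add: queue_sorted_def)
  have fin: "finite {bs::bool list. length bs = t}"
    using finite_lists_length_eq[of "UNIV :: bool set" t] by simp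
  have "measure lebesgue (\<Union>bs\<in>B. hom_simplex (fold (bisect (CARD('n)) c) bs vcol) :: (real ^ 'n::{finite,linorder}) set)
    \<le> (\<Sum>bs\<in>B. measure lebesgue (hom_simplex (fold (bisect (CARD('n)) c) bs vcol) :: (real ^ 'n::{finite,linorder}) set))"
    using finite_subset[OF B fin] by (intro measure_UNION_le fmeasurableD lmeasurable_hom_simplex)
  also have "\<dots> \<le> (\<Sum>bs\<in>B. ?r bs * ?D)"
    unfolding measure_hom_simplex[OF c] by (intro sum_mono mult_right_mono le) auto
  also have "\<dots> \<le> (\<Sum>bs\<in>{bs. length bs = t}. ?r bs * ?D)"
    using volume_ratio_nonneg[OF s card_pos] by (intro sum_mono2 fin B) auto
  finally show ?thesis by (simp only: affinity_eq_sum sum_distrib_right)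
qed

theorem mainTheorem5:
  assumes "CARD('n::{finite,linorder}) \<ge> 2"
  shows "\<exists>A \<in> sets (normalized_lebesgue :: (real ^ 'n::{finite,linorder}) measure).
           A \<subseteq> Delta \<and>
           emeasure normalized_lebesgue A = 1 \<and>
           Minkowski ` A \<in> sets normalized_lebesgue \<and>
           emeasure normalized_lebesgue (Minkowski ` A) = 0"
proof -
  let ?n = "CARD('n)"
  let ?Delta = "Delta :: (real ^ 'n::{finite,linorder}) set"
  let ?D = "measure lebesgue ?Delta"
  let ?m = "volume_ratio ?n 1 (\<lambda>_. 1)"
  define M where "M bs = (hom_simplex (fold (bisect ?n 1) bs vcol) :: (real ^ 'n::{finite,linorder}) set)" for bs
  define T where "T bs = (hom_simplex (fold (bisect ?n (1/2)) bs vcol) :: (real ^ 'n::{finite,linorder}) set)" for bs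
  have s: "queue_sorted ?n (\<lambda>_. 1)" by (simp add: queue_sorted_def)
  have m0: "0 \<le> ?m bs" for bs by (rule volume_ratio_nonneg[OF s card_pos])
  obtain h where h: "0 \<le> h" "h < 1" "\<And>k q. queue_sorted ?n q \<Longrightarrow> affinity ?n (k * (?n+1)) q \<le> h ^ k"
    using affinity_decay[OF card_pos[where 'n='n]] by blast
  \<comment> \<open>\<open>B k\<close> holds the words whose cylinder under \<open>M\<close> is
    smaller than that under \<open>T\<close>, and \<open>G k\<close> the others. The lengths are
    multiples of \<open>n + 1\<close> because \<open>affinity_decay\<close> gains one factor
    \<open>h\<close> per \<open>n + 1\<close> steps.\<close>
  define B where "B k = {bs. length bs = k * (?n+1) \<and> ?m bs < (1/2) ^ (k * (?n+1))}" for k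
  define G where "G k = {bs. length bs = k * (?n+1) \<and> (1/2) ^ (k * (?n+1)) \<le> ?m bs}" for k
  have fin: "finite (B k)" "finite (G k)" for k
    unfolding B_def G_def
    using finite_lists_length_eq[of "UNIV :: bool set" "k * (?n+1)"] by (auto intro: finite_subset[rotated])
  have meas: "(\<Union>bs\<in>B k. M bs) \<in> lmeasurable" "(\<Union>bs\<in>G k. T bs) \<in> lmeasurable" for k
    unfolding M_def T_def by (intro fmeasurable.finite_UN fin lmeasurable_hom_simplex)+
  have lt: "measure lebesgue (\<Union>bs\<in>B k. M bs) \<le> h ^ k * ?D" for k
  proof -
    have "measure lebesgue (\<Union>bs\<in>B k. M bs) \<le> affinity ?n (k * (?n+1)) (\<lambda>_. 1) * ?D"
      unfolding M_def
    proof (rule measure_UN_hom_simplex_le)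
      show "?m bs \<le> sqrt ((1/2) ^ (k * (?n+1)) * ?m bs)" if "bs \<in> B k" for bs
        using that m0[of bs] by (intro real_le_rsqrt) (auto simp: B_def power2_eq_square intro!: mult_right_mono)
    qed (auto simp: B_def)
    also have "\<dots> \<le> h ^ k * ?D" by (intro mult_right_mono h(3) s) auto
    finally show ?thesis .
  qed
  have gt: "measure lebesgue (\<Union>bs\<in>G k. T bs) \<le> h ^ k * ?D" for k
  proof -
    have "measure lebesgue (\<Union>bs\<in>G k. T bs) \<le> affinity ?n (k * (?n+1)) (\<lambda>_. 1) * ?D"
      unfolding T_def
    proof (rule measure_UN_hom_simplex_le)
      show "volume_ratio ?n (1/2) (\<lambda>_. 1) bs \<le> sqrt ((1/2) ^ (k * (?n+1)) * ?m bs)" if "bs \<in> G k" for bs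
        unfolding volume_ratio_half using that
        by (intro real_le_rsqrt) (auto simp: G_def power2_eq_square intro!: mult_left_mono)
    qed (auto simp: G_def)
    also have "\<dots> \<le> h ^ k * ?D" by (intro mult_right_mono h(3) s) auto
    finally show ?thesis .
  qed
  have sum: "summable (\<lambda>k. h ^ k * ?D)"
    using h by (intro summable_mult2 summable_geometric) auto
  have nullB: "limsup (\<lambda>k. \<Union>bs\<in>B k. M bs) \<in> null_sets lebesgue"
  proof (rule borel_cantelli_limsup1)
    show "(\<Union>bs\<in>B k. M bs) \<in> sets lebesgue" for k using meas(1) by (rule fmeasurableD)
    show "emeasure lebesgue (\<Union>bs\<in>B k. M bs) < \<infinity>" for k
      using fmeasurableD2[OF meas(1)[of k]] by (simp add: less_top)
    show "summable (\<lambda>k. measure lebesgue (\<Union>bs\<in>B k. M bs))"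
      by (rule summable_comparison_test'[OF sum, of 0]) (use lt in auto)
  qed
  have nullG: "limsup (\<lambda>k. \<Union>bs\<in>G k. T bs) \<in> null_sets lebesgue"
  proof (rule borel_cantelli_limsup1)
    show "(\<Union>bs\<in>G k. T bs) \<in> sets lebesgue" for k using meas(2) by (rule fmeasurableD)
    show "emeasure lebesgue (\<Union>bs\<in>G k. T bs) < \<infinity>" for k
      using fmeasurableD2[OF meas(2)[of k]] by (simp add: less_top)
    show "summable (\<lambda>k. measure lebesgue (\<Union>bs\<in>G k. T bs))"
      by (rule summable_comparison_test'[OF sum, of 0]) (use gt in auto)
  qed
  \<comment> \<open>These are the points that meet the cylinders of \<open>B k\<close> for only
    finitely many \<open>k\<close>.\<close>
  define A where "A = ?Delta - limsup (\<lambda>k. \<Union>bs\<in>B k. M bs)"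
  have Dm: "?Delta \<in> lmeasurable"
    unfolding Delta_eq_hom_simplex by (rule lmeasurable_hom_simplex)
  have Am: "A \<in> sets lebesgue"
    unfolding A_def using Dm nullB by (intro sets.Diff) (auto dest: fmeasurableD)
  have limsup_iff: "x \<in> limsup F \<longleftrightarrow> (\<forall>k. \<exists>l\<ge>k. x \<in> F l)" for x :: "real ^ 'n::{finite,linorder}" and F :: "nat \<Rightarrow> _ set"
    by (auto simp: limsup_INF_SUP)
  have img: "Minkowski ` A \<subseteq> limsup (\<lambda>k. \<Union>bs\<in>G k. T bs)"
  proof
    fix y assume "y \<in> Minkowski ` A"
    then obtain p where p: "p \<in> A" "y = Minkowski p" by blast
    \<comment> \<open>This is the very code that \<open>Minkowski\<close> selects, so
      \<open>p\<close> and its image \<open>y\<close> lie in cylinders of the same words under the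
      two maps.\<close>
    define a where "a = (SOME a. phi a = p)"
    have "p \<in> Delta" using p(1) by (simp add: A_def)
    then have a: "phi a = p" unfolding a_def by (rule someI_ex[OF exists_phi_code])
    have y: "y = upsilon a" by (simp add: p(2) Minkowski_def a_def)
    have pM: "p \<in> M (map a [0..<t])" for t
    proof -
      have "p \<in> (\<Inter>t. cylinder moenkemeyer_map a t)" unfolding phi_cylinders a by simp
      then have "p \<in> cylinder (proj_map 1) a t" unfolding moenkemeyer_map_eq by (rule INT_D) simp
      then show ?thesis unfolding M_def cylinder_eq_hom_simplex[OF zero_less_one] .
    qed
    have yT: "y \<in> T (map a [0..<t])" for t
    proof -
      have "y \<in> (\<Inter>t. cylinder tent_map a t)" unfolding upsilon_cylinders y by simp
      then have "y \<in> cylinder (proj_map (1/2)) a t" unfolding tent_map_eq by (rule INT_D) simp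
      then show ?thesis unfolding T_def by (subst (asm) cylinder_eq_hom_simplex) simp_all
    qed
    have "p \<notin> limsup (\<lambda>k. \<Union>bs\<in>B k. M bs)" using p(1) by (simp add: A_def)
    then obtain N where N: "\<And>k. N \<le> k \<Longrightarrow> p \<notin> (\<Union>bs\<in>B k. M bs)"
      unfolding limsup_iff by blast
    \<comment> \<open>From level \<open>N\<close> on the words of \<open>p\<close> avoid
      \<open>B k\<close> and hence belong to \<open>G k\<close>; this is what carries over to
      \<open>y\<close>.\<close>
    have G: "map a [0..<k * (?n+1)] \<in> G k" if "N \<le> k" for k
    proof -
      have "map a [0..<k * (?n+1)] \<notin> B k" using N[OF that] pM by blast
      moreover have "length (map a [0..<k * (?n+1)]) = k * (?n+1)" by simp
      ultimately show ?thesis unfolding B_def G_def by (simp only: mem_Collect_eq not_less simp_thms)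
    qed
    show "y \<in> limsup (\<lambda>k. \<Union>bs\<in>G k. T bs)"
      unfolding limsup_iff
    proof
      fix k
      have "y \<in> (\<Union>bs\<in>G (max N k). T bs)" by (rule UN_I[OF G[OF max.cobounded1]]) (rule yT)
      then show "\<exists>l\<ge>k. y \<in> (\<Union>bs\<in>G l. T bs)"
        by (intro exI[of _ "max N k"] conjI max.cobounded2)
    qed
  qed
  \<comment> \<open>Completeness of \<open>lebesgue\<close> makes the image measurable as a subset
    of a null set, without any regularity of \<open>Minkowski\<close>.\<close>
  then have null: "Minkowski ` A \<in> null_sets lebesgue"
    using nullG null_sets_completion_subset by blast
  have "emeasure lebesgue A = emeasure lebesgue ?Delta"
    unfolding A_def using nullB Dm by (intro emeasure_Diff_null_set) (auto dest: fmeasurableD)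
  moreover have "emeasure lebesgue ?Delta = ennreal ?D"
    using Dm by (simp add: emeasure_eq_measure2)
  moreover have "?Delta \<inter> A = A" by (auto simp: A_def)
  ultimately have one: "emeasure normalized_lebesgue A = 1"
    using Dm Am measure_Delta_pos[where 'n='n] unfolding normalized_lebesgue_def
    by (simp add: fmeasurableD divide_ennreal)
  have zero: "emeasure normalized_lebesgue (Minkowski ` A) = 0"
  proof -
    have "?Delta \<inter> Minkowski ` A \<in> null_sets lebesgue"
      using null Dm by (intro null_set_Int1) (auto dest: fmeasurableD)
    then show ?thesis
      unfolding normalized_lebesgue_def emeasure_uniform_measure[OF fmeasurableD[OF Dm] null_setsD2[OF null]]
      by (simp add: null_setsD1)
  qed
  show ?thesis
    using Am one zero null by (intro bexI[of _ A]) (auto simp: A_def normalized_lebesgue_def)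
qed

end
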